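(* Let $\{p(x,y)\}_{x,y\in V}$ be the transition probabilities of an irreducible Markov chain on a countable state space $V$, and let $\pi$ be an infinite stationary measure for $p$ (that is, $\sum_{x\in V}\pi(x)p(x,y)=\pi(y)$ for all $y\in V$, with $0<\pi(x)<\infty$ for each $x$ and $\pi(V)=\infty$). Suppose that $0<\gamma\le\frac12$ and $p(x,x)\ge\gamma$ for all $x\in V$. Let $\epsilon>0$ and $x,y\in V$. If the integer $n\ge 0$ satisfies $$n\ge 1+\frac{(1-\gamma)^2}{\gamma^2}\int_{4(\pi(x)\wedge\pi(y))}^{4/\epsilon}\frac{4\,du}{u\,\Phi^2(u)},$$ then $$\left|\frac{p^n(x,y)}{\pi(y)}\right|\le\epsilon.$$
   Context: $p^n(x,y)$ denotes the $n$-step transition probability and $\alpha\wedge\beta=\min\{\alpha,\beta\}$. For $x,y\in V$ let $Q(x,y)=\pi(x)p(x,y)$, and for $S,A\subset V$ let $Q(S,A)=\sum_{s\in S,a\in A}Q(s,a)$. For nonempty $S\subset V$ with $\pi(S)<\infty$ let $\Phi_S=Q(S,S^c)/\pi(S)$. The conductance profile is $\Phi(r)=\inf\{\Phi_S:\ \emptyset\ne S\subset V,\ \pi(S)\le r\}$ for $r>0$ (with $\inf\emptyset=+\infty$, $1/\infty=0$, $1/0=+\infty$). *)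

theory Defs
  imports "HOL-Probability.Probability"
begin

(* A Markov chain on a countable state space is given by its kernel K: the transition
   probability p(x,y) is pmf (K x) y, and p^n(x,y) is pmf (n_step K n x) y.
   Sums of nonnegative terms are nonnegative integrals over counting measures, with values
   in ennreal, so that they always exist. *)

primrec n_step :: "('v \<Rightarrow> 'v pmf) \<Rightarrow> nat \<Rightarrow> 'v \<Rightarrow> 'v pmf" where
  "n_step K 0 x = return_pmf x"
| "n_step K (Suc n) x = bind_pmf (K x) (n_step K n)"

definition irreducible_chain :: "('v \<Rightarrow> 'v pmf) \<Rightarrow> bool" where
  "irreducible_chain K \<longleftrightarrow> (\<forall>x y. \<exists>n. 0 < pmf (n_step K n x) y)"

definition weight :: "('v \<Rightarrow> real) \<Rightarrow> 'v set \<Rightarrow> ennreal" where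
  "weight \<pi> S = (\<integral>\<^sup>+x. ennreal (\<pi> x) \<partial>count_space S)"

definition stationary :: "('v \<Rightarrow> 'v pmf) \<Rightarrow> ('v \<Rightarrow> real) \<Rightarrow> bool" where
  "stationary K \<pi> \<longleftrightarrow>
     (\<forall>y. (\<integral>\<^sup>+x. ennreal (\<pi> x * pmf (K x) y) \<partial>count_space UNIV) = ennreal (\<pi> y))"

definition flow :: "('v \<Rightarrow> 'v pmf) \<Rightarrow> ('v \<Rightarrow> real) \<Rightarrow> 'v set \<Rightarrow> 'v set \<Rightarrow> ennreal" where
  "flow K \<pi> S A = (\<integral>\<^sup>+s. (\<integral>\<^sup>+a. ennreal (\<pi> s * pmf (K s) a) \<partial>count_space A) \<partial>count_space S)"

definition conductance :: "('v \<Rightarrow> 'v pmf) \<Rightarrow> ('v \<Rightarrow> real) \<Rightarrow> 'v set \<Rightarrow> ennreal" where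
  "conductance K \<pi> S = flow K \<pi> S (- S) / weight \<pi> S"

(* The infimum over the empty family is top, i.e. infinity, in ennreal. *)
definition conductance_profile :: "('v \<Rightarrow> 'v pmf) \<Rightarrow> ('v \<Rightarrow> real) \<Rightarrow> real \<Rightarrow> ennreal" where
  "conductance_profile K \<pi> r =
     (INF S\<in>{S. S \<noteq> {} \<and> weight \<pi> S \<le> ennreal r}. conductance K \<pi> S)"

(* The integral from a to b of a nonnegative, possibly infinite-valued function, with the
   usual sign convention if b < a. *)
definition oriented_nn_integral :: "real \<Rightarrow> real \<Rightarrow> (real \<Rightarrow> ennreal) \<Rightarrow> ereal" where
  "oriented_nn_integral a b f =
     (if a \<le> b then enn2ereal (\<integral>\<^sup>+u\<in>{a..b}. f u \<partial>lborel)
      else - enn2ereal (\<integral>\<^sup>+u\<in>{b..a}. f u \<partial>lborel))"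

end

theory Submission
  imports Defs
begin

text \<open>The proof follows the evolving sets of Morris and Peres. From a set \<open>S\<close> of states, draw
\<open>u\<close> uniformly from \<open>[0, 1)\<close> and move to the set of those \<open>y\<close> for which the stationary flow from
\<open>S\<close> into \<open>y\<close> exceeds \<open>u * \<pi> y\<close>. No process is constructed: the argument only uses the transition
operator \<open>evolve\<close> of this random set, acting on functions of sets, and its powers. Write \<open>E\<close> for
the resulting expectations and \<open>S\<^sub>n\<close> for the set after \<open>n\<close> moves.

\<^bold>\<open>Evolving sets represent the chain.\<close> The operator sends the sum of \<open>\<pi> * \<phi>\<close> over a set to the
sum of \<open>\<pi>\<close> times the one-step average of \<open>\<phi>\<close> (\<open>evolve_wsum\<close>). Hence the weight \<open>\<pi>(S\<^sub>n)\<close> is a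
martingale, and \<open>\<pi> x * p\<^sup>n(x, y)\<close> can be read off from the sets that evolve from \<open>{x}\<close>. Splitting the
time as \<open>m + k\<close> and reversing the second part, which is driven by the time reversal of the chain,
turns \<open>\<pi> x * p\<^sup>n(x, y)\<close> into the expectation of \<open>\<pi>(S \<inter> S')\<close> for two independent evolving sets, one
from \<open>{x}\<close> and one from \<open>{y}\<close>. Since \<open>\<pi>(S \<inter> S')\<close> is at most the product of the square roots of
\<open>\<pi>(S)\<close> and \<open>\<pi>(S')\<close>, the expectation factors: \<open>p\<^sup>n(x, y) / \<pi> y\<close> is at most \<open>L\<^sub>m(x) * L'\<^sub>k(y)\<close>,
where \<open>L\<^sub>m(x)\<close> is \<open>E (sqrt (\<pi>(S\<^sub>m))) / \<pi> x\<close> (\<open>n_step_le_inv_root_mean_product\<close>). It suffices to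
bring each factor below \<open>sqrt \<epsilon>\<close> in half of the time.

\<^bold>\<open>The factors decay.\<close> One move makes \<open>\<pi>(S)\<close> fluctuate: because the chain is lazy, the set can
only grow when \<open>u < \<gamma>\<close> and can only shrink when \<open>u \<ge> 1 - \<gamma>\<close>, and the mean relative change in
these two cases is at least \<open>a = \<Phi>\<^sub>S / (1 - \<gamma>)\<close> in absolute value. The square root is strictly
concave, so its expectation drops at least by a factor \<open>1 - \<gamma> * a\<^sup>2 / 4\<close>, which is at most
\<open>1 - \<kappa> * \<Phi>\<^sub>S\<^sup>2\<close> for \<open>\<kappa> = \<gamma>\<^sup>2 / (2 * (1 - \<gamma>)\<^sup>2)\<close> (\<open>conductance_contraction\<close>). A bound on
\<open>evolve root_weight\<close> that is linear in the square root of the weight and in the weight itself, the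
latter being a martingale, converts this into
\<open>L\<^sub>n\<^sub>+\<^sub>1 \<le> L\<^sub>n * (1 - \<kappa> * \<Phi>(u\<^sub>n)\<^sup>2 / 2)\<close> with \<open>u\<^sub>n = 4 / L\<^sub>n\<^sup>2\<close> (\<open>inv_root_mean_step\<close>).

\<^bold>\<open>The decay is compared with the integral.\<close> The numbers \<open>u\<^sub>n\<close> start at \<open>4 * \<pi> x\<close> and \<open>ln u\<^sub>n\<close>
grows by at least \<open>\<kappa> * \<Phi>(u\<^sub>n)\<^sup>2\<close> in each step. As \<open>\<Phi>\<close> is decreasing, each step uses up at least
\<open>4 * \<kappa>\<close> of the integral of \<open>4 / (u * \<Phi>(u)\<^sup>2)\<close>, so \<open>u\<^sub>n\<close> reaches \<open>4 / \<epsilon>\<close> in time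
(\<open>inv_root_mean_square_le\<close>). The halving of the time accounts for the factor two between \<open>4 * \<kappa>\<close>
and the constant of the theorem, and its rounding for the summand \<open>1\<close>.\<close>

section \<open>Measurability of functions of sets\<close>

text \<open>The product sigma-algebra, transported along the identification of sets with their indicator
functions. A set-valued map is measurable as soon as membership of every single state is.\<close>
definition set_algebra :: "'v set measure" where
  "set_algebra = vimage_algebra UNIV (\<lambda>S v. v \<in> S) (Pi\<^sub>M UNIV (\<lambda>_. count_space UNIV))"

lemma measurable_mem_set_algebra [measurable]: "(\<lambda>S. v \<in> S) \<in> measurable set_algebra (count_space UNIV)"
proof -
  have "(\<lambda>S v. v \<in> S) \<in> measurable set_algebra (Pi\<^sub>M UNIV (\<lambda>_. count_space (UNIV :: bool set)))"
    unfolding set_algebra_def by (rule measurable_vimage_algebra1) (auto simp: space_PiM)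
  from measurable_component_singleton[THEN measurable_compose[OF this], of v]
  show ?thesis by simp
qed

lemma measurable_set_algebraI:
  assumes "\<And>v. Measurable.pred N (\<lambda>x. v \<in> g x)"
  shows "g \<in> measurable N set_algebra"
  unfolding set_algebra_def
  by (rule measurable_vimage_algebra2) (auto intro!: measurable_PiM_single' assms)

lemma borel_measurable_nn_integral_count_space:
  fixes f :: "'a \<Rightarrow> 'v::countable \<Rightarrow> ennreal"
  assumes "\<And>v. (\<lambda>x. f x v) \<in> borel_measurable N"
  shows "(\<lambda>x. \<integral>\<^sup>+v. f x v \<partial>count_space UNIV) \<in> borel_measurable N"
proof (rule sigma_finite_measure.borel_measurable_nn_integral)
  show "sigma_finite_measure (count_space (UNIV :: 'v set))"
    by (rule sigma_finite_measure_count_space)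
  have "(\<lambda>(v, x). f x v) \<in> borel_measurable (count_space UNIV \<Otimes>\<^sub>M N)"
    by (rule measurable_pair_measure_countable1) (auto simp: assms)
  then show "(\<lambda>(x, v). f x v) \<in> borel_measurable (N \<Otimes>\<^sub>M count_space UNIV)"
    by (subst (asm) measurable_pair_swap_iff) simp
qed

lemma nn_integral_count_space_swap:
  fixes f :: "'v::countable \<Rightarrow> 'v \<Rightarrow> ennreal"
  shows "(\<integral>\<^sup>+x. (\<integral>\<^sup>+y. f x y \<partial>count_space UNIV) \<partial>count_space UNIV) =
         (\<integral>\<^sup>+y. (\<integral>\<^sup>+x. f x y \<partial>count_space UNIV) \<partial>count_space UNIV)"
  by (rule nn_integral_count_space_nn_integral) auto

lemma nn_integral_restrict_indicator:
  "(\<integral>\<^sup>+x. f x \<partial>count_space S) = (\<integral>\<^sup>+x. indicator S x * f x \<partial>count_space UNIV)"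
  by (subst nn_integral_count_space_indicator) (auto simp: mult.commute)

lemma n_step_Suc': "n_step K (Suc n) x = bind_pmf (n_step K n x) K"
proof (induction n arbitrary: x)
  case 0
  have "n_step K 0 = return_pmf" by auto
  then show ?case by (simp add: bind_return_pmf bind_return_pmf')
next
  case (Suc n)
  have "n_step K (Suc (Suc n)) x = bind_pmf (K x) (\<lambda>z. bind_pmf (n_step K n z) K)"
    using Suc by (simp cong: bind_pmf_cong)
  then show ?case by (simp add: bind_assoc_pmf)
qed

lemma n_step_add: "n_step K (m + n) x = bind_pmf (n_step K m x) (n_step K n)"
  by (induction m arbitrary: x) (simp_all add: bind_return_pmf bind_assoc_pmf cong: bind_pmf_cong)

section \<open>Evolving sets of a lazy chain\<close>

locale lazy_chain =
  fixes K :: "'v::countable \<Rightarrow> 'v pmf" and \<pi> :: "'v \<Rightarrow> real" and \<gamma> :: real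
  assumes \<pi>_pos: "0 < \<pi> v"
    and stationary: "stationary K \<pi>"
    and \<gamma>_pos: "0 < \<gamma>" and \<gamma>_le: "\<gamma> \<le> 1 / 2"
    and lazy: "\<gamma> \<le> pmf (K v) v"
begin

definition wsum :: "('v \<Rightarrow> ennreal) \<Rightarrow> 'v set \<Rightarrow> ennreal" where
  "wsum \<phi> S = (\<integral>\<^sup>+v. indicator S v * (ennreal (\<pi> v) * \<phi> v) \<partial>count_space UNIV)"

definition inflow :: "'v set \<Rightarrow> 'v \<Rightarrow> ennreal" where
  "inflow S y = wsum (\<lambda>s. ennreal (pmf (K s) y)) S"

text \<open>The probability that \<open>y\<close> belongs to the set that evolves from \<open>S\<close> in one move.\<close>
definition entry_prob :: "'v set \<Rightarrow> 'v \<Rightarrow> real" where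
  "entry_prob S y = enn2real (inflow S y) / \<pi> y"

text \<open>The comparison is strict so that the empty set stays empty for every \<open>u \<ge> 0\<close>, and not only for
almost every one.\<close>
definition next_set :: "'v set \<Rightarrow> real \<Rightarrow> 'v set" where
  "next_set S u = {y. u < entry_prob S y}"

text \<open>The transition operator of the evolving sets: the expectation of \<open>F\<close> after one move from \<open>S\<close>.\<close>
definition evolve :: "('v set \<Rightarrow> ennreal) \<Rightarrow> 'v set \<Rightarrow> ennreal" where
  "evolve F S = (\<integral>\<^sup>+u. indicator {0..<1} u * F (next_set S u) \<partial>lborel)"

lemma \<pi>_nonneg [simp]: "0 \<le> \<pi> v"
  using \<pi>_pos[of v] by simp

lemma wsum_eq_weight: "wsum (\<lambda>_. 1) S = weight \<pi> S"
  unfolding wsum_def weight_def by (subst (2) nn_integral_restrict_indicator) simp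

lemma borel_measurable_wsum [measurable]: "wsum \<phi> \<in> borel_measurable set_algebra"
  unfolding wsum_def[abs_def]
  by (rule borel_measurable_nn_integral_count_space) measurable

lemma wsum_mono: "(\<And>v. v \<in> S \<Longrightarrow> \<phi> v \<le> \<psi> v) \<Longrightarrow> S \<subseteq> S' \<Longrightarrow> wsum \<phi> S \<le> wsum \<psi> S'"
  unfolding wsum_def by (intro nn_integral_mono) (auto intro!: mult_left_mono split: split_indicator)

lemma inflow_UNIV: "inflow UNIV y = ennreal (\<pi> y)"
  using stationary by (simp add: inflow_def wsum_def stationary_def ennreal_mult)

lemma inflow_le: "inflow S y \<le> ennreal (\<pi> y)"
  using wsum_mono[of S "\<lambda>s. ennreal (pmf (K s) y)" "\<lambda>s. ennreal (pmf (K s) y)" UNIV]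
  unfolding inflow_UNIV[symmetric] inflow_def by simp

lemma inflow_Compl: "inflow S y + inflow (- S) y = ennreal (\<pi> y)"
proof -
  have "inflow S y + inflow (- S) y = inflow UNIV y"
    unfolding inflow_def wsum_def
    by (subst nn_integral_add[symmetric]) (auto intro!: nn_integral_cong split: split_indicator)
  then show ?thesis by (simp add: inflow_UNIV)
qed

lemma inflow_eq: "inflow S y = ennreal (\<pi> y * entry_prob S y)"
proof -
  have "inflow S y < top" using inflow_le[of S y] by (simp add: le_less_trans)
  then show ?thesis using \<pi>_pos[of y] by (simp add: entry_prob_def)
qed

lemma entry_prob_nonneg: "0 \<le> entry_prob S y" by (simp add: entry_prob_def)

lemma entry_prob_le_1: "entry_prob S y \<le> 1"
  using inflow_le[of S y] \<pi>_pos[of y] by (simp add: inflow_eq)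

lemma entry_prob_measurable [measurable]: "(\<lambda>S. entry_prob S y) \<in> borel_measurable set_algebra"
  unfolding entry_prob_def inflow_def by measurable

lemma next_set_measurable: "(\<lambda>(S, u). next_set S u) \<in> measurable (set_algebra \<Otimes>\<^sub>M borel) set_algebra"
  by (rule measurable_set_algebraI) (simp add: next_set_def split_beta)

lemma next_set_measurable1 [measurable]: "next_set S \<in> measurable borel set_algebra"
  by (rule measurable_set_algebraI) (simp add: next_set_def)

lemma evolve_measurable [measurable (raw)]:
  assumes [measurable]: "F \<in> borel_measurable set_algebra"
  shows "evolve F \<in> borel_measurable set_algebra"
proof -
  have [measurable]: "(\<lambda>(S, u). next_set S u) \<in> measurable (set_algebra \<Otimes>\<^sub>M lborel) set_algebra"
    using next_set_measurable by (simp cong: measurable_cong_sets)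
  show ?thesis unfolding evolve_def[abs_def]
    by measurable
qed

lemma evolve_mono: "(\<And>S. F S \<le> G S) \<Longrightarrow> evolve F S \<le> evolve G S"
  unfolding evolve_def by (intro nn_integral_mono mult_left_mono) auto

lemma evolve_cmult:
  assumes [measurable]: "F \<in> borel_measurable set_algebra"
  shows "evolve (\<lambda>S. c * F S) S = c * evolve F S"
proof -
  have "evolve (\<lambda>S. c * F S) S = (\<integral>\<^sup>+u. c * (indicator {0..<1} u * F (next_set S u)) \<partial>lborel)"
    unfolding evolve_def by (simp add: ac_simps)
  then show ?thesis unfolding evolve_def by (subst (asm) nn_integral_cmult) auto
qed

lemma evolve_add:
  assumes [measurable]: "F \<in> borel_measurable set_algebra" "G \<in> borel_measurable set_algebra"
  shows "evolve (\<lambda>S. F S + G S) S = evolve F S + evolve G S"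
  unfolding evolve_def by (simp add: distrib_left nn_integral_add)

text \<open>Tonelli: a state \<open>y\<close> lies in the next set exactly for the parameters below \<open>entry_prob S y\<close>. The
density \<open>r\<close> is kept general because the square root of the weight is later bounded with different
multipliers on different ranges of the parameter.\<close>
lemma integral_wsum_next_set:
  assumes [measurable]: "r \<in> borel_measurable borel"
  shows "(\<integral>\<^sup>+u. r u * wsum \<phi> (next_set S u) \<partial>lborel) =
    (\<integral>\<^sup>+y. ennreal (\<pi> y) * \<phi> y * (\<integral>\<^sup>+u. r u * indicator {..<entry_prob S y} u \<partial>lborel) \<partial>count_space UNIV)"
proof -
  have "(\<integral>\<^sup>+u. r u * wsum \<phi> (next_set S u) \<partial>lborel) =
     (\<integral>\<^sup>+u. (\<integral>\<^sup>+y. (ennreal (\<pi> y) * \<phi> y) * (r u * indicator {..<entry_prob S y} u) \<partial>count_space UNIV) \<partial>lborel)"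
    unfolding wsum_def
    by (intro nn_integral_cong, subst nn_integral_cmult[symmetric])
       (auto intro!: nn_integral_cong simp: next_set_def ac_simps split: split_indicator)
  also have "\<dots> = (\<integral>\<^sup>+y. (\<integral>\<^sup>+u. (ennreal (\<pi> y) * \<phi> y) * (r u * indicator {..<entry_prob S y} u) \<partial>lborel) \<partial>count_space UNIV)"
    by (rule nn_integral_count_space_nn_integral) auto
  finally show ?thesis by (simp add: nn_integral_cmult)
qed

text \<open>The duality between the evolving sets and the chain. By Tonelli each \<open>y\<close> contributes its term
\<open>\<pi> y * \<phi> y\<close> with probability \<open>entry_prob S y\<close>, so altogether \<open>\<phi> y\<close> is weighted with the inflow
from \<open>S\<close>; summing over the target first gives the average of \<open>\<phi>\<close> after one step of the chain.\<close>
lemma evolve_wsum: "evolve (wsum \<phi>) S = wsum (\<lambda>x. \<integral>\<^sup>+z. \<phi> z \<partial>measure_pmf (K x)) S"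
proof -
  have *: "(\<integral>\<^sup>+u. indicator {0..<1} u * indicator {..<entry_prob S y} u \<partial>lborel) = ennreal (entry_prob S y)" for y
  proof -
    have "(\<integral>\<^sup>+u. indicator {0..<1} u * indicator {..<entry_prob S y} u \<partial>lborel) =
          (\<integral>\<^sup>+u. indicator {0..<entry_prob S y} u \<partial>lborel)"
      using entry_prob_le_1[of S y] by (intro nn_integral_cong) (auto split: split_indicator)
    then show ?thesis using entry_prob_nonneg[of S y] by simp
  qed
  have "evolve (wsum \<phi>) S = (\<integral>\<^sup>+y. \<phi> y * inflow S y \<partial>count_space UNIV)"
    unfolding evolve_def
    by (subst integral_wsum_next_set) (auto simp: * inflow_eq ennreal_mult entry_prob_nonneg ac_simps)
  also have "\<dots> = (\<integral>\<^sup>+y. (\<integral>\<^sup>+s. \<phi> y * (indicator S s * (ennreal (\<pi> s) * ennreal (pmf (K s) y)))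
       \<partial>count_space UNIV) \<partial>count_space UNIV)"
    unfolding inflow_def wsum_def by (subst nn_integral_cmult) auto
  also have "\<dots> = (\<integral>\<^sup>+s. (\<integral>\<^sup>+y. (indicator S s * ennreal (\<pi> s)) * (ennreal (pmf (K s) y) * \<phi> y)
       \<partial>count_space UNIV) \<partial>count_space UNIV)"
    by (subst nn_integral_count_space_swap) (simp add: ac_simps)
  also have "\<dots> = wsum (\<lambda>x. \<integral>\<^sup>+z. \<phi> z \<partial>measure_pmf (K x)) S"
    unfolding wsum_def by (subst nn_integral_cmult) (auto simp: nn_integral_measure_pmf ac_simps)
  finally show ?thesis .
qed

lemma evolve_pow_measurable [measurable (raw)]:
  "F \<in> borel_measurable set_algebra \<Longrightarrow> (evolve ^^ n) F \<in> borel_measurable set_algebra"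
  by (induction n) auto

lemma evolve_pow_mono: "(\<And>S. F S \<le> G S) \<Longrightarrow> (evolve ^^ n) F S \<le> (evolve ^^ n) G S"
  by (induction n arbitrary: S) (auto intro!: evolve_mono)

lemma evolve_pow_cmult:
  assumes [measurable]: "F \<in> borel_measurable set_algebra"
  shows "(evolve ^^ n) (\<lambda>S. c * F S) S = c * (evolve ^^ n) F S"
proof (induction n arbitrary: S)
  case (Suc n)
  have "(evolve ^^ n) (\<lambda>S. c * F S) = (\<lambda>S. c * (evolve ^^ n) F S)" using Suc by auto
  then show ?case by (simp add: evolve_cmult)
qed simp

lemma evolve_pow_add:
  assumes [measurable]: "F \<in> borel_measurable set_algebra" "G \<in> borel_measurable set_algebra"
  shows "(evolve ^^ n) (\<lambda>S. F S + G S) S = (evolve ^^ n) F S + (evolve ^^ n) G S"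
proof (induction n arbitrary: S)
  case (Suc n)
  have "(evolve ^^ n) (\<lambda>S. F S + G S) = (\<lambda>S. (evolve ^^ n) F S + (evolve ^^ n) G S)" using Suc by auto
  then show ?case by (simp add: evolve_add)
qed simp

lemma evolve_pow_wsum: "(evolve ^^ n) (wsum \<phi>) S = wsum (\<lambda>x. \<integral>\<^sup>+z. \<phi> z \<partial>measure_pmf (n_step K n x)) S"
proof (induction n arbitrary: \<phi> S)
  case (Suc n)
  have "(evolve ^^ Suc n) (wsum \<phi>) S = (evolve ^^ n) (wsum (\<lambda>x. \<integral>\<^sup>+z. \<phi> z \<partial>measure_pmf (K x))) S"
    by (simp add: funpow_swap1 evolve_wsum[abs_def])
  also have "\<dots> = wsum (\<lambda>x. \<integral>\<^sup>+z. \<phi> z \<partial>measure_pmf (n_step K (Suc n) x)) S"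
    unfolding Suc n_step_Suc' by (simp add: nn_integral_bind_pmf)
  finally show ?case .
qed (simp add: nn_integral_return_pmf)

text \<open>The weight of the evolving set is a martingale: this is the duality for constant \<open>\<phi>\<close>.\<close>
lemma evolve_pow_weight: "(evolve ^^ n) (weight \<pi>) S = weight \<pi> S"
  using evolve_pow_wsum[of n "\<lambda>_. 1" S]
  by (simp add: wsum_eq_weight[abs_def] measure_pmf.emeasure_space_1)

lemma wsum_singleton: "wsum \<phi> {x} = ennreal (\<pi> x) * \<phi> x"
proof -
  have "wsum \<phi> {x} = (\<integral>\<^sup>+v. (ennreal (\<pi> x) * \<phi> x) * indicator {x} v \<partial>count_space UNIV)"
    unfolding wsum_def by (intro nn_integral_cong) (auto split: split_indicator)
  then show ?thesis by (simp add: nn_integral_cmult)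
qed

end

section \<open>Square roots and a three-step density\<close>

text \<open>The next set can have infinite weight, for \<open>u = 0\<close>, and it must then receive the root \<open>top\<close>, not the
default value \<open>0\<close> of \<open>enn2real top\<close>.\<close>
definition esqrt :: "ennreal \<Rightarrow> ennreal" where
  "esqrt w = (if w = top then top else ennreal (sqrt (enn2real w)))"

lemma esqrt_top [simp]: "esqrt top = top"
  by (simp add: esqrt_def)

lemma esqrt_ennreal: "0 \<le> w \<Longrightarrow> esqrt (ennreal w) = ennreal (sqrt w)"
  by (simp add: esqrt_def)

lemma esqrt_0 [simp]: "esqrt 0 = 0"
  by (simp add: esqrt_def)

lemma borel_measurable_esqrt [measurable]: "esqrt \<in> borel_measurable borel"
  unfolding esqrt_def[abs_def] by measurable

text \<open>The tangent of the square root at \<open>s\<^sup>2\<close>. It replaces Jensen's inequality: after choosing \<open>s\<close> for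
each range of the parameter, only integrals of weights remain.\<close>
lemma esqrt_tangent:
  assumes "0 < s"
  shows "esqrt w \<le> ennreal (1 / (2 * s)) * w + ennreal (s / 2)"
proof (cases w)
  case (real r)
  have "0 \<le> (sqrt r - s)\<^sup>2" by simp
  then have "sqrt r * s * 2 \<le> r + s\<^sup>2"
    using real by (simp add: power2_diff)
  then have "sqrt r \<le> 1 / (2 * s) * r + s / 2"
    using assms by (simp add: field_simps power2_eq_square)
  then show ?thesis
    using real assms by (simp add: esqrt_ennreal ennreal_leI flip: ennreal_mult ennreal_plus)
next
  case top
  then show ?thesis using assms by (simp add: ennreal_mult_top)
qed

lemma le_esqrt_mult_esqrt:
  assumes "w \<le> v" "w \<le> v'"
  shows "w \<le> esqrt v * esqrt v'"
proof (cases "w = 0 \<or> v = top \<or> v' = top")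
  case True
  have "esqrt x \<noteq> 0" if "x \<noteq> 0" for x
    by (cases x) (use that in \<open>auto simp: esqrt_ennreal\<close>)
  moreover have "w = 0 \<or> (v \<noteq> 0 \<and> v' \<noteq> 0)" using assms by auto
  ultimately have "w = 0 \<or> esqrt v * esqrt v' = top"
    using True by (metis esqrt_top ennreal_mult_top ennreal_top_mult)
  then show ?thesis by auto
next
  case False
  obtain r where r: "v = ennreal r" "0 \<le> r" using False by (cases v) auto
  obtain r' where r': "v' = ennreal r'" "0 \<le> r'" using False by (cases v') auto
  have "w < top" using assms(1) r by (simp add: le_less_trans)
  then obtain t where t: "w = ennreal t" "0 \<le> t" by (cases w) auto
  have "sqrt t \<le> sqrt r" "sqrt t \<le> sqrt r'" using assms r r' t by simp_all
  then have "sqrt t * sqrt t \<le> sqrt r * sqrt r'" using t by (intro mult_mono) auto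
  then show ?thesis using r r' t by (simp add: esqrt_ennreal ennreal_leI flip: ennreal_mult)
qed

text \<open>In the contraction estimate \<open>g\<close> is the laziness \<open>\<gamma>\<close>; the three ranges of \<open>u\<close> are the one where
the set can only grow, the middle one, and the one where it can only shrink.\<close>
definition three_step :: "real \<Rightarrow> real \<Rightarrow> real \<Rightarrow> real \<Rightarrow> real" where
  "three_step g c1 c2 u = (if u < g then c1 else if u < 1 - g then 1 else c2)"

text \<open>The integral of \<open>three_step g c1 c2\<close> over \<open>[0, t)\<close>, for \<open>0 \<le> t \<le> 1\<close>.\<close>
definition three_step_integral :: "real \<Rightarrow> real \<Rightarrow> real \<Rightarrow> real \<Rightarrow> real" where
  "three_step_integral g c1 c2 t =
     c1 * min t g + max 0 (min t (1 - g) - g) + c2 * max 0 (t - (1 - g))"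

lemma borel_measurable_three_step [measurable]: "three_step g c1 c2 \<in> borel_measurable borel"
  unfolding three_step_def[abs_def] by measurable

lemma nn_integral_three_step:
  assumes "0 \<le> g" "g \<le> 1 / 2" "0 \<le> t" "t \<le> 1" "0 \<le> c1" "0 \<le> c2"
  shows "(\<integral>\<^sup>+u. indicator {0..<1} u * ennreal (three_step g c1 c2 u) * indicator {..<t} u \<partial>lborel) =
    ennreal (three_step_integral g c1 c2 t)"
proof -
  have "(\<integral>\<^sup>+u. indicator {0..<1} u * ennreal (three_step g c1 c2 u) * indicator {..<t} u \<partial>lborel) =
    (\<integral>\<^sup>+u. ennreal c1 * indicator {0..<min t g} u + indicator {g..<max g (min t (1 - g))} u +
       ennreal c2 * indicator {1 - g..<max (1 - g) t} u \<partial>lborel)"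
    using assms by (intro nn_integral_cong) (auto simp: three_step_def split: split_indicator)
  also have "\<dots> = ennreal c1 * ennreal (min t g) + ennreal (max g (min t (1 - g)) - g) +
       ennreal c2 * ennreal (max (1 - g) t - (1 - g))"
    using assms by (simp add: nn_integral_add nn_integral_cmult)
  also have "\<dots> = ennreal (three_step_integral g c1 c2 t)"
  proof -
    have *: "max g (min t (1 - g)) - g = max 0 (min t (1 - g) - g)"
      "max (1 - g) t - (1 - g) = max 0 (t - (1 - g))" by auto
    show ?thesis
      unfolding * three_step_integral_def using assms
      by (subst ennreal_plus, simp, simp, subst ennreal_plus) (auto simp: ennreal_mult)
  qed
  finally show ?thesis .
qed

text \<open>For \<open>c1 \<le> 1 \<le> c2\<close> the integral is a convex function of \<open>t\<close>. Hence it lies below its chord on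
\<open>[0, 1 - g]\<close>, the range of \<open>entry_prob S y\<close> for \<open>y\<close> outside \<open>S\<close>, and below its chord on \<open>[g, 1]\<close>, the
range for \<open>y\<close> inside \<open>S\<close>; these are the next two lemmas, multiplied by \<open>1 - g\<close>. The chords are
linear in \<open>entry_prob S y\<close>, so that summation over \<open>y\<close> only involves flows and weights.\<close>
lemma three_step_integral_le_low:
  assumes "0 < g" "g \<le> 1 / 2" "0 \<le> t" "t \<le> 1 - g" "c1 \<le> 1"
  shows "(1 - g) * three_step_integral g c1 c2 t \<le> (c1 * g + 1 - 2 * g) * t"
proof (cases "t \<le> g")
  case True
  have "0 \<le> (1 - c1) * ((1 - 2 * g) * t)" using assms by simp
  then show ?thesis using True assms by (simp add: three_step_integral_def algebra_simps)
next
  case False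
  have "0 \<le> (1 - g - t) * (g * (1 - c1))" using assms by simp
  then show ?thesis using False assms by (simp add: three_step_integral_def algebra_simps)
qed

lemma three_step_integral_le_high:
  assumes "0 < g" "g \<le> 1 / 2" "g \<le> t" "t \<le> 1" "1 \<le> c2"
  shows "(1 - g) * three_step_integral g c1 c2 t \<le>
    (1 - g) * (c1 * g + 1 - 2 * g + c2 * g) - (1 - t) * (1 - 2 * g + c2 * g)"
proof (cases "t \<le> 1 - g")
  case True
  have "0 \<le> (t - g) * (g * (c2 - 1))" using assms by simp
  then show ?thesis using True assms by (simp add: three_step_integral_def algebra_simps)
next
  case False
  have "0 \<le> (1 - t) * ((1 - 2 * g) * (c2 - 1))" using assms by simp
  then show ?thesis using False assms by (simp add: three_step_integral_def algebra_simps)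
qed

text \<open>The loss in concavity for relative changes \<open>a\<close> and \<open>- a\<close>. Placing the tangents at \<open>1 + a / 2\<close> and
\<open>1 - a / 2\<close>, instead of at the optimal square roots of \<open>1 + a\<close> and \<open>1 - a\<close>, keeps everything rational
and is defined at \<open>a = 1\<close> as well.\<close>
lemma tangent_constants:
  fixes a :: real
  assumes "0 \<le> a" "a \<le> 1"
  shows "(1 + a) / (1 + a / 2) + (1 - a) / (1 - a / 2) \<le> 2 - a\<^sup>2 / 2"
proof -
  have pos: "0 < 4 - a\<^sup>2" using assms power_le_one[of a 2] by simp
  have "(1 + a) / (1 + a / 2) + (1 - a) / (1 - a / 2) = 2 - 2 * a\<^sup>2 / (4 - a\<^sup>2)"
    using assms pos by (simp add: field_simps power2_eq_square)
  moreover have "2 * a\<^sup>2 / (4 - a\<^sup>2) \<ge> 2 * a\<^sup>2 / 4"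
    using pos by (intro divide_left_mono) auto
  ultimately show ?thesis by simp
qed

section \<open>Contraction of the root weight by conductance\<close>

context lazy_chain begin

text \<open>Laziness keeps a fraction \<open>\<gamma>\<close> of the mass of \<open>y\<close> in place.\<close>
lemma inflow_ge: "y \<in> S \<Longrightarrow> ennreal (\<gamma> * \<pi> y) \<le> inflow S y"
proof -
  assume "y \<in> S"
  have "ennreal (\<gamma> * \<pi> y) \<le> ennreal (\<pi> y) * ennreal (pmf (K y) y)"
    using lazy[of y] \<pi>_pos[of y] \<gamma>_pos
    by (simp add: mult.commute mult_right_mono ennreal_leI flip: ennreal_mult)
  also have "\<dots> = wsum (\<lambda>s. ennreal (pmf (K s) y)) {y}" by (simp add: wsum_singleton)
  also have "\<dots> \<le> inflow S y" unfolding inflow_def using \<open>y \<in> S\<close> by (intro wsum_mono) auto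
  finally show ?thesis .
qed

lemma entry_prob_ge: "y \<in> S \<Longrightarrow> \<gamma> \<le> entry_prob S y"
  using inflow_ge[of y S] \<pi>_pos[of y] \<gamma>_pos
  by (simp add: inflow_eq mult.commute entry_prob_nonneg)

lemma entry_prob_Compl: "entry_prob S y + entry_prob (- S) y = 1"
  using inflow_Compl[of S y] \<pi>_pos[of y]
  by (simp add: inflow_eq entry_prob_nonneg flip: ennreal_plus distrib_left)

lemma entry_prob_le: "y \<notin> S \<Longrightarrow> entry_prob S y \<le> 1 - \<gamma>"
  using entry_prob_ge[of y "- S"] entry_prob_Compl[of S y] by simp

lemma flow_eq: "flow K \<pi> S A = (\<integral>\<^sup>+y. indicator A y * inflow S y \<partial>count_space UNIV)"
proof -
  have "flow K \<pi> S A = (\<integral>\<^sup>+s. indicator S s * (\<integral>\<^sup>+a. indicator A a * ennreal (\<pi> s * pmf (K s) a)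
      \<partial>count_space UNIV) \<partial>count_space UNIV)"
    unfolding flow_def by (simp only: nn_integral_restrict_indicator[of S] nn_integral_restrict_indicator[of A])
  also have "\<dots> = (\<integral>\<^sup>+s. (\<integral>\<^sup>+a. indicator S s * (indicator A a * ennreal (\<pi> s * pmf (K s) a))
      \<partial>count_space UNIV) \<partial>count_space UNIV)"
    by (subst nn_integral_cmult) auto
  also have "\<dots> = (\<integral>\<^sup>+a. (\<integral>\<^sup>+s. indicator A a * (indicator S s * (ennreal (\<pi> s) * ennreal (pmf (K s) a)))
      \<partial>count_space UNIV) \<partial>count_space UNIV)"
    by (subst nn_integral_count_space_swap) (simp add: ac_simps ennreal_mult)
  also have "\<dots> = (\<integral>\<^sup>+y. indicator A y * inflow S y \<partial>count_space UNIV)"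
    unfolding inflow_def wsum_def by (subst nn_integral_cmult) auto
  finally show ?thesis .
qed

lemma nn_integral_inflow: "(\<integral>\<^sup>+y. inflow S y \<partial>count_space UNIV) = weight \<pi> S"
proof -
  have "(\<integral>\<^sup>+y. inflow S y \<partial>count_space UNIV) =
    (\<integral>\<^sup>+s. (\<integral>\<^sup>+y. (indicator S s * ennreal (\<pi> s)) * ennreal (pmf (K s) y)
       \<partial>count_space UNIV) \<partial>count_space UNIV)"
    unfolding inflow_def wsum_def by (subst nn_integral_count_space_swap) (simp add: ac_simps)
  also have "\<dots> = weight \<pi> S"
    unfolding wsum_eq_weight[symmetric] wsum_def
    by (subst nn_integral_cmult) (auto simp: nn_integral_pmf_eq_1)
  finally show ?thesis .
qed

text \<open>Mass starting in \<open>S\<close> either stays in \<open>S\<close> or is counted in the flow across the boundary.\<close>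
lemma inside_plus_flow:
  "(\<integral>\<^sup>+y. indicator S y * inflow S y \<partial>count_space UNIV) + flow K \<pi> S (- S) = weight \<pi> S"
  unfolding flow_eq nn_integral_inflow[symmetric]
  by (subst nn_integral_add[symmetric]) (auto intro!: nn_integral_cong split: split_indicator)

lemma weight_pos: "S \<noteq> {} \<Longrightarrow> 0 < weight \<pi> S"
proof -
  assume "S \<noteq> {}"
  then obtain x where x: "x \<in> S" by auto
  have "0 < ennreal (\<pi> x)" using \<pi>_pos by simp
  also have "\<dots> = wsum (\<lambda>_. 1) {x}" by (simp add: wsum_singleton)
  also have "\<dots> \<le> wsum (\<lambda>_. 1) S" using x by (intro wsum_mono) auto
  finally show ?thesis by (simp add: wsum_eq_weight)
qed

definition root_weight :: "'v set \<Rightarrow> ennreal" where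
  "root_weight S = esqrt (weight \<pi> S)"

lemma borel_measurable_weight [measurable]: "weight \<pi> \<in> borel_measurable set_algebra"
  unfolding wsum_eq_weight[abs_def, symmetric] by measurable

lemma borel_measurable_root_weight [measurable]: "root_weight \<in> borel_measurable set_algebra"
  unfolding root_weight_def[abs_def] by measurable

definition \<kappa> :: real where
  "\<kappa> = \<gamma>\<^sup>2 / (2 * (1 - \<gamma>)\<^sup>2)"

lemma \<kappa>_bounds: "0 < \<kappa>" "\<kappa> \<le> 1 / 2"
proof -
  have "\<gamma>\<^sup>2 \<le> (1 - \<gamma>)\<^sup>2" using \<gamma>_pos \<gamma>_le by (intro power_mono) auto
  then show "\<kappa> \<le> 1 / 2" using \<gamma>_le by (simp add: \<kappa>_def field_simps)
  show "0 < \<kappa>" using \<gamma>_pos \<gamma>_le by (simp add: \<kappa>_def)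
qed

text \<open>One move of the evolving set lowers the expected root of its weight. For \<open>w = \<pi>(S)\<close> the tangent
bound with \<open>s = \<sigma> u * sqrt w\<close>, where \<open>\<sigma>\<close> is \<open>1 + a / 2\<close>, \<open>1\<close>, \<open>1 - a / 2\<close> on the three ranges of
\<open>u\<close>, reduces the claim to a bound on the integral \<open>X\<close> of \<open>\<pi>(S\<^sub>1) / \<sigma> u\<close>. By Tonelli \<open>X\<close> is the sum
over \<open>y\<close> of \<open>\<pi> y * H (entry_prob S y)\<close>, where \<open>H\<close> is the integral of the three-step density, and the two
chord bounds for \<open>H\<close> give \<open>X \<le> H 1 * w - d * f\<close> with the boundary flow \<open>f\<close> and the difference \<open>d\<close> of
the slopes. The value of \<open>a\<close> is the relative change of weight that the flow forces on each of the
two outer ranges. The constant \<open>\<gamma> * a\<^sup>2 / 4\<close> obtained in this way is weakened to \<open>\<gamma>\<^sup>2 * a\<^sup>2 / 2\<close>.\<close>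
lemma conductance_contraction:
  assumes S: "S \<noteq> {}" "weight \<pi> S < top"
  shows "evolve root_weight S \<le> ennreal (1 - \<kappa> * (enn2real (conductance K \<pi> S))\<^sup>2) * root_weight S"
    and "conductance K \<pi> S \<le> 1"
proof -
  note g = \<gamma>_pos \<gamma>_le
  obtain w where w: "weight \<pi> S = ennreal w" "0 < w"
    using weight_pos[OF S(1)] S(2) by (cases "weight \<pi> S") auto
  define B where "B = (\<integral>\<^sup>+y. indicator S y * inflow S y \<partial>count_space UNIV)"
  have "B + flow K \<pi> S (- S) = ennreal w"
    unfolding B_def w(1)[symmetric] by (rule inside_plus_flow)
  then have fin: "B < top" "flow K \<pi> S (- S) < top"
    by (auto simp: less_top[symmetric] dest: sym)
  then obtain b f where b: "B = ennreal b" "0 \<le> b" and f: "flow K \<pi> S (- S) = ennreal f" "0 \<le> f"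
    by (metis enn2real_nonneg ennreal_enn2real_if less_irrefl)
  have bf: "b + f = w"
    using \<open>B + _ = _\<close> b f w by (simp flip: ennreal_plus)
  have "ennreal \<gamma> * weight \<pi> S = (\<integral>\<^sup>+y. ennreal \<gamma> * (indicator S y * (ennreal (\<pi> y) * 1)) \<partial>count_space UNIV)"
    unfolding wsum_eq_weight[symmetric] wsum_def by (subst nn_integral_cmult) auto
  also have "\<dots> \<le> B"
    unfolding B_def using inflow_ge \<gamma>_pos
    by (intro nn_integral_mono) (auto split: split_indicator simp: ennreal_mult)
  finally have "\<gamma> * w \<le> b"
    using g b w by (simp flip: ennreal_mult)
  with bf have f_le: "f \<le> (1 - \<gamma>) * w" by (simp add: algebra_simps)
  define a where "a = f / (w * (1 - \<gamma>))"
  have a: "0 \<le> a" "a \<le> 1" using f f_le w g by (auto simp: a_def field_simps)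
  have cond: "conductance K \<pi> S = ennreal (a * (1 - \<gamma>))"
    using f w g by (simp add: conductance_def a_def divide_ennreal)
  have "a * (1 - \<gamma>) \<le> 1 * 1" using a g by (intro mult_mono) auto
  then show "conductance K \<pi> S \<le> 1" by (simp add: cond)
  define s1 s2 c1 c2 where "s1 = 1 + a / 2" "s2 = 1 - a / 2" "c1 = 1 / s1" "c2 = 1 / s2"
  have s: "0 < s1" "0 < s2" "0 \<le> c1" "c1 \<le> 1" "1 \<le> c2"
    using a by (auto simp: s1_s2_c1_c2_def)
  define H1 k1 k2 d D where "H1 = c1 * \<gamma> + 1 - 2 * \<gamma> + c2 * \<gamma>"
    and "k1 = (c1 * \<gamma> + 1 - 2 * \<gamma>) / (1 - \<gamma>)"
    and "k2 = (1 - 2 * \<gamma> + c2 * \<gamma>) / (1 - \<gamma>)"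
    and "d = k2 - k1" and "D = k2 - H1"
  have k: "(1 - \<gamma>) * k1 = c1 * \<gamma> + 1 - 2 * \<gamma>" "(1 - \<gamma>) * k2 = 1 - 2 * \<gamma> + c2 * \<gamma>"
    using g by (auto simp: k1_def k2_def)
  have dval: "(1 - \<gamma>) * d = \<gamma> * (c2 - c1)" using k unfolding d_def by (simp add: algebra_simps)
  have "0 \<le> c1 * \<gamma>" "0 \<le> \<gamma> * (c2 - c1)" using s g by simp_all
  then have "0 \<le> (1 - \<gamma>) * k1" "0 \<le> (1 - \<gamma>) * d" using k dval g by linarith+
  then have k1_nonneg: "0 \<le> k1" and d_nonneg: "0 \<le> d" using g by (auto simp: zero_le_mult_iff)
  have "(1 - \<gamma>) * D = \<gamma> * ((1 - 2 * \<gamma>) * (1 - c1)) + \<gamma> * \<gamma> * (c2 - c1)"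
  proof -
    have "(1 - \<gamma>) * D = (1 - \<gamma>) * k2 - (1 - \<gamma>) * H1" unfolding D_def by (rule right_diff_distrib)
    then show ?thesis unfolding k(2) H1_def by (simp add: algebra_simps)
  qed
  also have "\<dots> \<ge> 0" using s g by (intro add_nonneg_nonneg mult_nonneg_nonneg) auto
  finally have D_nonneg: "0 \<le> D" using g by (simp add: zero_le_mult_iff)
  \<comment> \<open>The chords have slope \<open>k1\<close> outside and \<open>k2 = k1 + d\<close> inside \<open>S\<close>; the latter meets the
    vertical axis at \<open>- D\<close>. As extended nonnegative reals cannot be subtracted, \<open>D\<close> is carried on the
    left until the total is known to be finite.\<close>
  define H where "H = three_step_integral \<gamma> c1 c2"
  have H_nonneg: "0 \<le> H t" if "0 \<le> t" for t
    using that s g by (auto simp: H_def three_step_integral_def)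
  have H_out: "H t \<le> k1 * t" if "0 \<le> t" "t \<le> 1 - \<gamma>" for t
  proof -
    have "(1 - \<gamma>) * H t \<le> ((1 - \<gamma>) * k1) * t"
      unfolding H_def k using that s g by (intro three_step_integral_le_low) auto
    then show ?thesis using g by (simp add: mult.assoc)
  qed
  have H_in: "H t + D \<le> k1 * t + d * t" if "\<gamma> \<le> t" "t \<le> 1" for t
  proof -
    have "(1 - \<gamma>) * H t \<le> (1 - \<gamma>) * H1 - (1 - t) * ((1 - \<gamma>) * k2)"
      unfolding H_def H1_def k using that s g by (intro three_step_integral_le_high) auto
    then have "(1 - \<gamma>) * H t \<le> (1 - \<gamma>) * (H1 - (1 - t) * k2)"
      by (simp add: algebra_simps)
    then have "H t \<le> H1 - (1 - t) * k2" using g by simp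
    then show ?thesis unfolding D_def d_def by (simp add: algebra_simps)
  qed
  define X where "X = (\<integral>\<^sup>+u. (indicator {0..<1} u * ennreal (three_step \<gamma> c1 c2 u)) * weight \<pi> (next_set S u) \<partial>lborel)"
  have X: "X = (\<integral>\<^sup>+y. ennreal (\<pi> y * H (entry_prob S y)) \<partial>count_space UNIV)"
    unfolding X_def wsum_eq_weight[symmetric] H_def
    using g s by (subst integral_wsum_next_set)
      (auto simp: nn_integral_three_step entry_prob_nonneg entry_prob_le_1 H_nonneg[unfolded H_def] ennreal_mult)
  have pt: "ennreal (\<pi> y * H (entry_prob S y)) + ennreal D * (indicator S y * (ennreal (\<pi> y) * 1)) \<le>
      ennreal k1 * inflow S y + ennreal d * (indicator S y * inflow S y)" for y
  proof (cases "y \<in> S")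
    case True
    have "\<pi> y * (H (entry_prob S y) + D) \<le> \<pi> y * (k1 * entry_prob S y + d * entry_prob S y)"
      using H_in[of "entry_prob S y"] entry_prob_ge[OF True] entry_prob_le_1[of S y] by (intro mult_left_mono) auto
    then show ?thesis
      using True k1_nonneg d_nonneg D_nonneg H_nonneg entry_prob_nonneg
      by (simp add: inflow_eq ennreal_leI algebra_simps flip: ennreal_mult ennreal_plus)
  next
    case False
    have "\<pi> y * H (entry_prob S y) \<le> \<pi> y * (k1 * entry_prob S y)"
      using H_out[of "entry_prob S y"] entry_prob_le[OF False] entry_prob_nonneg by (intro mult_left_mono) auto
    then show ?thesis
      using False k1_nonneg entry_prob_nonneg
      by (simp add: inflow_eq ennreal_leI algebra_simps flip: ennreal_mult)
  qed
  have "X + ennreal D * wsum (\<lambda>_. 1) S =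
    (\<integral>\<^sup>+y. ennreal (\<pi> y * H (entry_prob S y)) + ennreal D * (indicator S y * (ennreal (\<pi> y) * 1)) \<partial>count_space UNIV)"
    unfolding X wsum_def by (simp add: nn_integral_add nn_integral_cmult)
  also have "\<dots> \<le> (\<integral>\<^sup>+y. ennreal k1 * inflow S y + ennreal d * (indicator S y * inflow S y) \<partial>count_space UNIV)"
    by (intro nn_integral_mono pt)
  also have "\<dots> = ennreal k1 * weight \<pi> S + ennreal d * B"
    unfolding B_def by (simp add: nn_integral_add nn_integral_cmult nn_integral_inflow)
  finally have XD: "X + ennreal (D * w) \<le> ennreal (k1 * w + d * b)"
    using w b k1_nonneg d_nonneg D_nonneg by (simp add: wsum_eq_weight ennreal_mult)
  then have "X < top" by (auto simp: less_top[symmetric] top_unique)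
  then obtain x where x: "X = ennreal x" "0 \<le> x" by (cases X) auto
  have "x + D * w \<le> k1 * w + d * b"
    using XD x D_nonneg w k1_nonneg d_nonneg b by (simp flip: ennreal_plus)
  then have "x \<le> H1 * w - d * f"
  proof -
    have "H1 * w - d * f - x = k1 * w + d * b - (x + D * w)"
      unfolding D_def d_def bf[symmetric] by (simp add: algebra_simps)
    then show ?thesis using \<open>x + D * w \<le> _\<close> by linarith
  qed
  also have "d * f = ((1 - \<gamma>) * d) * (a * w)" using w g by (simp add: a_def)
  also have "H1 * w - ((1 - \<gamma>) * d) * (a * w) = w * (1 - 2 * \<gamma> + \<gamma> * ((1 + a) * c1 + (1 - a) * c2))"
    unfolding dval H1_def by (simp add: algebra_simps)
  also have "\<dots> \<le> w * (1 - 2 * \<gamma> + \<gamma> * (2 - a\<^sup>2 / 2))"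
    using tangent_constants[OF a] w g unfolding s1_s2_c1_c2_def
    by (intro mult_left_mono add_left_mono) auto
  finally have x_le: "x \<le> w * (1 - \<gamma> * a\<^sup>2 / 2)" by (simp add: algebra_simps)
  have one: "(\<integral>\<^sup>+u. indicator {0..<1} u * ennreal (three_step \<gamma> s1 s2 u) \<partial>lborel) = 1"
  proof -
    have "(\<integral>\<^sup>+u. indicator {0..<1} u * ennreal (three_step \<gamma> s1 s2 u) \<partial>lborel) =
      (\<integral>\<^sup>+u. indicator {0..<1} u * ennreal (three_step \<gamma> s1 s2 u) * indicator {..<1} u \<partial>lborel)"
      by (intro nn_integral_cong) (auto split: split_indicator)
    also have "\<dots> = ennreal (three_step_integral \<gamma> s1 s2 1)"
      using g s by (intro nn_integral_three_step) auto
    also have "three_step_integral \<gamma> s1 s2 1 = 1"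
      using g by (simp add: three_step_integral_def s1_s2_c1_c2_def algebra_simps)
    finally show ?thesis by simp
  qed
  have tan: "root_weight R \<le> ennreal (1 / (2 * sqrt w)) * (ennreal (three_step \<gamma> c1 c2 u) * weight \<pi> R) +
      ennreal (sqrt w / 2) * ennreal (three_step \<gamma> s1 s2 u)" for R u
  proof -
    have "three_step \<gamma> c1 c2 u = 1 / three_step \<gamma> s1 s2 u" "0 < three_step \<gamma> s1 s2 u"
      using s by (auto simp: three_step_def s1_s2_c1_c2_def)
    then obtain \<sigma> where \<sigma>: "three_step \<gamma> s1 s2 u = \<sigma>" "three_step \<gamma> c1 c2 u = 1 / \<sigma>" "0 < \<sigma>"
      by auto
    have "ennreal (1 / (2 * sqrt w)) * ennreal (1 / \<sigma>) = ennreal (1 / (2 * (\<sigma> * sqrt w)))"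
      using w \<sigma>(3) by (simp add: ac_simps flip: ennreal_mult)
    moreover have "ennreal (sqrt w / 2) * ennreal \<sigma> = ennreal (\<sigma> * sqrt w / 2)"
      using w \<sigma>(3) by (simp add: ac_simps flip: ennreal_mult)
    moreover have "root_weight R \<le> ennreal (1 / (2 * (\<sigma> * sqrt w))) * weight \<pi> R + ennreal (\<sigma> * sqrt w / 2)"
      unfolding root_weight_def using w \<sigma>(3) by (intro esqrt_tangent) simp
    ultimately show ?thesis unfolding \<sigma> by (simp add: mult.assoc[symmetric])
  qed
  have "evolve root_weight S \<le> (\<integral>\<^sup>+u. ennreal (1 / (2 * sqrt w)) *
        (indicator {0..<1} u * ennreal (three_step \<gamma> c1 c2 u) * weight \<pi> (next_set S u)) +
      ennreal (sqrt w / 2) * (indicator {0..<1} u * ennreal (three_step \<gamma> s1 s2 u)) \<partial>lborel)"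
    unfolding evolve_def by (intro nn_integral_mono) (auto split: split_indicator intro: tan)
  also have "\<dots> = ennreal (1 / (2 * sqrt w)) * X + ennreal (sqrt w / 2)"
    unfolding X_def by (simp add: nn_integral_add nn_integral_cmult one)
  also have "\<dots> = ennreal (1 / (2 * sqrt w) * x + sqrt w / 2)"
    using x w by (simp flip: ennreal_mult ennreal_plus)
  also have "\<dots> \<le> ennreal (1 / (2 * sqrt w) * (w * (1 - \<gamma> * a\<^sup>2 / 2)) + sqrt w / 2)"
    using x_le w by (intro ennreal_leI add_right_mono mult_left_mono) auto
  also have "1 / (2 * sqrt w) * (w * (1 - \<gamma> * a\<^sup>2 / 2)) + sqrt w / 2 = (1 - \<gamma> * a\<^sup>2 / 4) * sqrt w"
  proof -
    have "1 / (2 * z) * ((z * z) * e) = z * e / 2" if "0 < z" for z e :: real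
      using that by simp
    from this[of "sqrt w" "1 - \<gamma> * a\<^sup>2 / 2"]
    have "1 / (2 * sqrt w) * (w * (1 - \<gamma> * a\<^sup>2 / 2)) = sqrt w * (1 - \<gamma> * a\<^sup>2 / 2) / 2"
      using w by (simp only: real_sqrt_mult_self real_sqrt_gt_0_iff abs_of_pos)
    then show ?thesis by (simp add: algebra_simps)
  qed
  also have "ennreal \<dots> \<le> ennreal ((1 - \<gamma>\<^sup>2 * a\<^sup>2 / 2) * sqrt w)"
  proof -
    have "\<gamma> * a\<^sup>2 * \<gamma> \<le> \<gamma> * a\<^sup>2 * (1 / 2)" using g by (intro mult_left_mono) auto
    then show ?thesis using w by (intro ennreal_leI mult_right_mono) (auto simp: power2_eq_square algebra_simps)
  qed
  also have "\<gamma>\<^sup>2 * a\<^sup>2 / 2 = \<kappa> * (enn2real (conductance K \<pi> S))\<^sup>2"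
    using a g by (simp add: cond \<kappa>_def power_mult_distrib)
  also have "ennreal ((1 - \<dots>) * sqrt w) =
      ennreal (1 - \<kappa> * (enn2real (conductance K \<pi> S))\<^sup>2) * root_weight S"
    using w by (simp add: root_weight_def esqrt_ennreal ennreal_mult'')
  finally show "evolve root_weight S \<le> ennreal (1 - \<kappa> * (enn2real (conductance K \<pi> S))\<^sup>2) * root_weight S" .
qed

end

section \<open>The conductance profile\<close>

lemma borel_measurable_antimono_ennreal:
  fixes f :: "real \<Rightarrow> ennreal"
  assumes "\<And>s t. s \<le> t \<Longrightarrow> f t \<le> f s"
  shows "f \<in> borel_measurable borel"
proof (rule borel_measurableI_greater)
  fix y
  have "is_interval {u. y < f u}"
    unfolding is_interval_1 using assms by (auto intro: less_le_trans)
  then show "{u \<in> space borel. y < f u} \<in> sets borel"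
    by (simp add: real_interval_borel_measurable)
qed

lemma nn_integral_reciprocal:
  assumes "0 < s" "s \<le> t" "0 \<le> k"
  shows "(\<integral>\<^sup>+u. ennreal (k / u) * indicator {s<..t} u \<partial>lborel) = ennreal (k * ln (t / s))"
proof -
  have "AE u in lborel. u \<noteq> s" by (rule AE_lborel_singleton)
  then have "(\<integral>\<^sup>+u. ennreal (k / u) * indicator {s<..t} u \<partial>lborel) =
        (\<integral>\<^sup>+u. ennreal (k / u) * indicator {s..t} u \<partial>lborel)"
    by (intro nn_integral_cong_AE) (auto split: split_indicator elim!: eventually_mono)
  also have "\<dots> = ennreal (k * ln t - k * ln s)"
    using assms by (intro nn_integral_FTC_Icc) (auto intro!: derivative_eq_intros)
  also have "k * ln t - k * ln s = k * ln (t / s)"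
    using assms by (simp add: ln_div algebra_simps)
  finally show ?thesis .
qed

lemma reciprocal_square_le:
  assumes "0 < u" "0 < p" "P \<le> ennreal p"
  shows "ennreal (4 / p\<^sup>2 / u) \<le> 4 / (ennreal u * P\<^sup>2)"
proof -
  obtain r where r: "P = ennreal r" "0 \<le> r" using assms(3) by (cases P) (auto simp: top_unique)
  have rp: "r \<le> p" using assms r by simp
  show ?thesis
  proof (cases "r = 0")
    case True
    then show ?thesis using r by (simp add: ennreal_divide_zero)
  next
    case False
    then have "r > 0" using r by simp
    have "u * r\<^sup>2 \<le> u * p\<^sup>2" using assms rp r by (intro mult_left_mono power_mono) auto
    then have "4 / (u * p\<^sup>2) \<le> 4 / (u * r\<^sup>2)"
      using \<open>r > 0\<close> assms by (intro divide_left_mono) auto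
    then have "ennreal (4 / p\<^sup>2 / u) \<le> ennreal (4 / (u * r\<^sup>2))"
      by (intro ennreal_leI) (simp add: mult.commute)
    also have "\<dots> = 4 / (ennreal u * P\<^sup>2)"
      using \<open>r > 0\<close> assms r by (simp add: ennreal_power flip: divide_ennreal ennreal_mult)
    finally show ?thesis .
  qed
qed

lemma conductance_profile_le:
  "S \<noteq> {} \<Longrightarrow> weight \<pi> S \<le> ennreal r \<Longrightarrow> conductance_profile K \<pi> r \<le> conductance K \<pi> S"
  unfolding conductance_profile_def by (intro INF_lower) auto

lemma conductance_profile_antimono:
  "r \<le> s \<Longrightarrow> conductance_profile K \<pi> s \<le> conductance_profile K \<pi> r"
  unfolding conductance_profile_def
  by (intro INF_superset_mono) (auto intro: order_trans ennreal_leI)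

lemma borel_measurable_conductance_profile [measurable]:
  "conductance_profile K \<pi> \<in> borel_measurable borel"
  by (rule borel_measurable_antimono_ennreal) (rule conductance_profile_antimono)

section \<open>Decay of the root weight\<close>

context lazy_chain begin

lemma weight_singleton: "weight \<pi> {x} = ennreal (\<pi> x)"
  using wsum_singleton[of "\<lambda>_. 1" x] by (simp add: wsum_eq_weight)

lemma root_weight_singleton: "root_weight {x} = ennreal (sqrt (\<pi> x))"
  by (simp add: root_weight_def weight_singleton esqrt_ennreal)

lemma evolve_root_weight_empty: "evolve root_weight {} = 0"
proof -
  have "inflow {} y = 0" for y by (simp add: inflow_def wsum_def)
  then have "next_set {} u = {}" if "0 \<le> u" for u using that by (simp add: next_set_def entry_prob_def)
  moreover have "root_weight {} = 0" by (simp add: root_weight_def wsum_def flip: wsum_eq_weight)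
  ultimately have vanish: "indicator {0..<1} u * root_weight (next_set {} u) = 0" for u :: real
    by (auto split: split_indicator)
  show ?thesis unfolding evolve_def vanish by simp
qed

lemma evolve_root_weight_le: "evolve root_weight S \<le> root_weight S"
proof (cases "S = {} \<or> weight \<pi> S = top")
  case True
  then show ?thesis by (auto simp: evolve_root_weight_empty root_weight_def)
next
  case False
  then have S: "S \<noteq> {}" "weight \<pi> S < top" by (auto simp: less_top)
  have "evolve root_weight S \<le> ennreal (1 - \<kappa> * (enn2real (conductance K \<pi> S))\<^sup>2) * root_weight S"
    by (rule conductance_contraction(1)[OF S])
  also have "\<dots> \<le> ennreal 1 * root_weight S"
    using \<kappa>_bounds by (intro mult_right_mono ennreal_leI) auto
  finally show ?thesis by simp
qed

text \<open>Under the measure weighted by \<open>\<pi>(S\<^sub>n) / \<pi> x\<close>, which is a probability by the martingale property,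
this is the mean of \<open>1 / sqrt (\<pi>(S\<^sub>n))\<close> for the sets evolving from \<open>{x}\<close>.\<close>
definition inv_root_mean :: "nat \<Rightarrow> 'v \<Rightarrow> real" where
  "inv_root_mean n x = enn2real ((evolve ^^ n) root_weight {x}) / \<pi> x"

lemma evolve_pow_root_weight_decreasing: "(evolve ^^ Suc n) root_weight S \<le> (evolve ^^ n) root_weight S"
  by (simp add: funpow_swap1) (intro evolve_pow_mono evolve_root_weight_le)

lemma evolve_pow_root_weight_le: "(evolve ^^ n) root_weight S \<le> root_weight S"
  by (induction n) (auto intro: order_trans[OF evolve_pow_root_weight_decreasing] simp del: funpow.simps(2))

lemma evolve_pow_root_weight_singleton: "(evolve ^^ n) root_weight {x} = ennreal (\<pi> x * inv_root_mean n x)"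
proof -
  have "(evolve ^^ n) root_weight {x} < top"
    using evolve_pow_root_weight_le[of n "{x}"] by (simp add: root_weight_singleton le_less_trans)
  then show ?thesis using \<pi>_pos[of x] by (simp add: inv_root_mean_def)
qed

lemma inv_root_mean_nonneg: "0 \<le> inv_root_mean n x"
  by (simp add: inv_root_mean_def)

lemma inv_root_mean_Suc_le: "inv_root_mean (Suc n) x \<le> inv_root_mean n x"
  using evolve_pow_root_weight_decreasing[of n "{x}"] \<pi>_pos[of x] unfolding evolve_pow_root_weight_singleton
  by (simp add: inv_root_mean_nonneg)

lemma inv_root_mean_antimono: "m \<le> n \<Longrightarrow> inv_root_mean n x \<le> inv_root_mean m x"
  by (rule lift_Suc_antimono_le) (rule inv_root_mean_Suc_le)

lemma inv_root_mean_0: "\<pi> x * (inv_root_mean 0 x)\<^sup>2 = 1"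
  using \<pi>_pos[of x] by (simp add: inv_root_mean_def root_weight_singleton power_divide power2_eq_square)

lemma conductance_profile_le_1: "\<pi> x \<le> r \<Longrightarrow> conductance_profile K \<pi> r \<le> 1"
  using conductance_profile_le[of "{x}" \<pi> r K] conductance_contraction(2)[of "{x}"]
  by (simp add: weight_singleton ennreal_leI)

text \<open>The conductance bound gains the factor \<open>1 - c\<close> only on sets of weight at most \<open>4 / L\<^sup>2\<close>. On larger
sets \<open>sqrt w \<le> (L / 2) * w\<close>, so the missing part \<open>c * sqrt w\<close> is paid for by the weight. The bound
is linear in both and therefore survives taking expectations, where the mean weight is constant; this is what
allows the nonlinear rate to be evaluated at the mean. If \<open>L\<close> is the current mean, the additional
term costs half of the gain.\<close>
lemma evolve_root_weight_linear_bound: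
  assumes L: "0 < L" and x: "\<pi> x \<le> 4 / L\<^sup>2"
    and c: "c = \<kappa> * (enn2real (conductance_profile K \<pi> (4 / L\<^sup>2)))\<^sup>2"
  shows "evolve root_weight S \<le> ennreal (1 - c) * root_weight S + ennreal (c * (L / 2)) * weight \<pi> S"
    and "0 \<le> c" "c \<le> 1 / 2"
proof -
  define \<Phi> where "\<Phi> = conductance_profile K \<pi> (4 / L\<^sup>2)"
  have "\<Phi> \<le> 1" unfolding \<Phi>_def using x by (rule conductance_profile_le_1)
  then have "enn2real \<Phi> \<le> 1" using enn2real_mono[of \<Phi> 1] by simp
  then have sq: "(enn2real \<Phi>)\<^sup>2 \<le> 1" by (simp add: power_le_one)
  show c0: "0 \<le> c" using \<kappa>_bounds c by simp
  have "c \<le> 1 / 2 * 1" unfolding c \<Phi>_def[symmetric] using \<kappa>_bounds sq by (intro mult_mono) auto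
  then show c1: "c \<le> 1 / 2" by simp
  show "evolve root_weight S \<le> ennreal (1 - c) * root_weight S + ennreal (c * (L / 2)) * weight \<pi> S"
  proof (cases "S = {} \<or> weight \<pi> S = top")
    case True
    then show ?thesis using c1 by (auto simp: evolve_root_weight_empty root_weight_def ennreal_mult_top)
  next
    case False
    then have S: "S \<noteq> {}" "weight \<pi> S < top" by (auto simp: less_top)
    obtain w where w: "weight \<pi> S = ennreal w" "0 < w"
      using weight_pos[OF S(1)] S(2) by (cases "weight \<pi> S") auto
    have root_weight: "root_weight S = ennreal (sqrt w)" using w by (simp add: root_weight_def esqrt_ennreal)
    show ?thesis
    proof (cases "w \<le> 4 / L\<^sup>2")
      case True
      have "\<Phi> \<le> conductance K \<pi> S"
        unfolding \<Phi>_def using S(1) True w by (intro conductance_profile_le) (auto intro: ennreal_leI)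
      then have "enn2real \<Phi> \<le> enn2real (conductance K \<pi> S)"
        using conductance_contraction(2)[OF S] by (intro enn2real_mono) (auto simp: le_less_trans)
      then have "c \<le> \<kappa> * (enn2real (conductance K \<pi> S))\<^sup>2"
        unfolding c \<Phi>_def[symmetric] using \<kappa>_bounds by (intro mult_left_mono power_mono) auto
      then have "evolve root_weight S \<le> ennreal (1 - c) * root_weight S"
        using conductance_contraction(1)[OF S] by (elim order_trans) (intro mult_right_mono ennreal_leI, auto)
      then show ?thesis by (rule order_trans) simp
    next
      case False
      then have "(2 / L)\<^sup>2 \<le> w" by (simp add: power_divide)
      then have "2 / L \<le> sqrt w" by (rule real_le_rsqrt)
      then have "2 * sqrt w \<le> (L * sqrt w) * sqrt w"
        using L w by (intro mult_right_mono) (auto simp: field_simps)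
      then have "sqrt w \<le> L / 2 * w" using w by (simp add: mult.assoc)
      then have "c * sqrt w \<le> c * (L / 2 * w)" using c0 by (rule mult_left_mono)
      then have "sqrt w \<le> (1 - c) * sqrt w + c * (L / 2) * w" by (simp add: algebra_simps)
      then have "root_weight S \<le> ennreal ((1 - c) * sqrt w + c * (L / 2) * w)"
        unfolding root_weight by (rule ennreal_leI)
      also have "\<dots> = ennreal (1 - c) * root_weight S + ennreal (c * (L / 2)) * weight \<pi> S"
        using c0 c1 L w by (simp add: root_weight flip: ennreal_mult ennreal_plus)
      finally show ?thesis using evolve_root_weight_le[of S] by (rule order_trans[rotated])
    qed
  qed
qed

lemma inv_root_mean_step:
  assumes L: "0 < inv_root_mean n x"
  shows "inv_root_mean (Suc n) x \<le> inv_root_mean n x *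
    (1 - \<kappa> * (enn2real (conductance_profile K \<pi> (4 / (inv_root_mean n x)\<^sup>2)))\<^sup>2 / 2)"
proof -
  define L where "L = inv_root_mean n x"
  define c where "c = \<kappa> * (enn2real (conductance_profile K \<pi> (4 / L\<^sup>2)))\<^sup>2"
  have L0: "0 < L" using L by (simp add: L_def)
  have "L\<^sup>2 \<le> (inv_root_mean 0 x)\<^sup>2" unfolding L_def using inv_root_mean_antimono[of 0 n x] inv_root_mean_nonneg by (intro power_mono) auto
  then have "\<pi> x * L\<^sup>2 \<le> 1" using inv_root_mean_0[of x] \<pi>_pos[of x] by (metis mult_left_mono less_imp_le)
  then have x: "\<pi> x \<le> 4 / L\<^sup>2" using L0 by (simp add: field_simps)
  note aff = evolve_root_weight_linear_bound[OF L0 x c_def]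
  have "ennreal (\<pi> x * inv_root_mean (Suc n) x) = (evolve ^^ n) (evolve root_weight) {x}"
    by (simp add: funpow_swap1 flip: evolve_pow_root_weight_singleton)
  also have "\<dots> \<le> (evolve ^^ n) (\<lambda>S. ennreal (1 - c) * root_weight S + ennreal (c * (L / 2)) * weight \<pi> S) {x}"
    by (intro evolve_pow_mono aff)
  also have "\<dots> = ennreal (1 - c) * (evolve ^^ n) root_weight {x} + ennreal (c * (L / 2)) * weight \<pi> {x}"
    by (subst evolve_pow_add) (auto simp: evolve_pow_cmult evolve_pow_weight)
  also have "\<dots> = ennreal (\<pi> x * (L * (1 - c / 2)))"
    using aff(2,3) L0 \<pi>_pos[of x]
    by (simp add: evolve_pow_root_weight_singleton weight_singleton L_def[symmetric] algebra_simps flip: ennreal_mult ennreal_plus)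
  finally have "\<pi> x * inv_root_mean (Suc n) x \<le> \<pi> x * (L * (1 - c / 2))"
    using L0 aff(2,3) by (subst (asm) ennreal_le_iff) auto
  then show ?thesis using \<pi>_pos[of x] by (simp add: L_def c_def)
qed

text \<open>If the claim failed, then all \<open>v j = 4 / (inv_root_mean j x)\<^sup>2\<close> with \<open>j \<le> m\<close> would lie strictly below
\<open>4 / \<epsilon>\<close>. They increase from \<open>4 * \<pi> x\<close>, and each interval between consecutive ones contributes at least
\<open>4 * \<kappa>\<close> to the integral. The interval from \<open>v m\<close> to \<open>4 / \<epsilon>\<close> still has positive integral, so
the total would exceed \<open>4 * \<kappa> * m\<close>.\<close>
lemma inv_root_mean_square_le:
  assumes a: "0 < a" "a \<le> 4 * \<pi> x" and "0 < \<epsilon>"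
    and I: "(\<integral>\<^sup>+u\<in>{a..4 / \<epsilon>}. 4 / (ennreal u * (conductance_profile K \<pi> u)\<^sup>2) \<partial>lborel) \<le> ennreal (4 * \<kappa> * real m)"
  shows "(inv_root_mean m x)\<^sup>2 \<le> \<epsilon>"
proof (rule ccontr)
  assume "\<not> ?thesis"
  then have big: "\<epsilon> < (inv_root_mean m x)\<^sup>2" by simp
  define F where "F u = 4 / (ennreal u * (conductance_profile K \<pi> u)\<^sup>2)" for u
  have [measurable]: "F \<in> borel_measurable borel"
    unfolding F_def[abs_def] by (intro borel_measurable_divide_ennreal) measurable
  define b where "b = 4 / \<epsilon>"
  define v where "v j = 4 / (inv_root_mean j x)\<^sup>2" for j
  have inv_root_mean_pos: "0 < inv_root_mean j x" if "j \<le> m" for j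
  proof -
    have "inv_root_mean m x \<noteq> 0" using big \<open>0 < \<epsilon>\<close> by auto
    then show ?thesis using inv_root_mean_antimono[OF that, of x] inv_root_mean_nonneg[of m x] by linarith
  qed
  have v_pos: "0 < v j" if "j \<le> m" for j
    using inv_root_mean_pos[OF that] by (simp add: v_def)
  have v_mono: "v i \<le> v j" if "i \<le> j" "j \<le> m" for i j
    unfolding v_def using inv_root_mean_pos that inv_root_mean_antimono[of i j x]
    by (intro divide_left_mono power_mono mult_pos_pos zero_less_power) (auto simp: less_imp_le)
  have v_m: "v m < b"
    unfolding v_def b_def using big \<open>0 < \<epsilon>\<close>
    by (intro divide_strict_left_mono mult_pos_pos) auto
  have v_0: "v 0 = 4 * \<pi> x"
    using inv_root_mean_0[of x] inv_root_mean_pos[of 0] by (simp add: v_def field_simps)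
  have \<Phi>_le_1: "conductance_profile K \<pi> u \<le> 1" if "v 0 \<le> u" for u
    using that \<pi>_pos[of x] by (intro conductance_profile_le_1[of x]) (auto simp: v_0)
  \<comment> \<open>Half-open intervals fit together without overlap.\<close>
  define J where "J t = (\<integral>\<^sup>+u. F u * indicator {t<..b} u \<partial>lborel)" for t
  have J_I: "J t \<le> ennreal (4 * \<kappa> * real m)" if "v 0 \<le> t" for t
  proof -
    have "J t \<le> (\<integral>\<^sup>+u\<in>{a..4 / \<epsilon>}. F u \<partial>lborel)"
      unfolding J_def b_def using that a(2) by (intro nn_integral_mono) (auto simp: v_0 split: split_indicator)
    then show ?thesis using I unfolding F_def by simp
  qed
  have lower: "ennreal (4 / p\<^sup>2 * ln (t / s)) \<le> (\<integral>\<^sup>+u. F u * indicator {s<..t} u \<partial>lborel)"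
    if st: "0 < s" "s \<le> t" and p: "0 < p" "conductance_profile K \<pi> s \<le> ennreal p" for s t p
  proof -
    have pointwise: "ennreal (4 / p\<^sup>2 / u) \<le> F u" if "s < u" for u
    proof -
      have "conductance_profile K \<pi> u \<le> ennreal p"
        using conductance_profile_antimono[of s u K \<pi>] p(2) that by (meson less_imp_le order_trans)
      then show ?thesis unfolding F_def using that st p by (intro reciprocal_square_le) auto
    qed
    have "ennreal (4 / p\<^sup>2 * ln (t / s)) = (\<integral>\<^sup>+u. ennreal (4 / p\<^sup>2 / u) * indicator {s<..t} u \<partial>lborel)"
      by (rule nn_integral_reciprocal[symmetric]) (use st in auto)
    also have "\<dots> \<le> (\<integral>\<^sup>+u. F u * indicator {s<..t} u \<partial>lborel)"
      using pointwise by (intro nn_integral_mono) (simp split: split_indicator)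
    finally show ?thesis .
  qed
  \<comment> \<open>A vanishing profile would stay zero and make the integrand infinite up to \<open>b\<close>.\<close>
  have \<Phi>_pos: "conductance_profile K \<pi> (v j) \<noteq> 0" if "j \<le> m" for j
  proof
    assume 0: "conductance_profile K \<pi> (v j) = 0"
    have "v j < b" using v_mono[of j m] that v_m by simp
    have "F u = top" if "v j < u" for u
      using conductance_profile_antimono[of "v j" u K \<pi>] 0 that v_pos[OF \<open>j \<le> m\<close>]
      by (simp add: F_def ennreal_divide_zero)
    then have "J (v j) = (\<integral>\<^sup>+u. top * indicator {v j<..b} u \<partial>lborel)"
      unfolding J_def by (intro nn_integral_cong) (auto split: split_indicator)
    also have "\<dots> = top" using \<open>v j < b\<close> by (subst nn_integral_cmult) (auto simp: ennreal_top_mult)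
    finally show False using J_I[of "v j"] v_mono[of 0 j] that by (simp add: top_unique)
  qed
  have step: "ennreal (4 * \<kappa>) + J (v (Suc j)) \<le> J (v j)" if "Suc j \<le> m" for j
  proof -
    define p where "p = enn2real (conductance_profile K \<pi> (v j))"
    have "conductance_profile K \<pi> (v j) \<le> 1" using \<Phi>_le_1 v_mono[of 0 j] that by simp
    then have p: "conductance_profile K \<pi> (v j) = ennreal p"
      unfolding p_def by (simp add: le_less_trans)
    have "0 < p" using \<Phi>_pos[of j] that by (simp add: p) (auto simp: p_def order_less_le)
    have "p \<le> 1" using \<open>conductance_profile K \<pi> (v j) \<le> 1\<close> p by simp
    define c where "c = \<kappa> * p\<^sup>2"
    have "p\<^sup>2 \<le> 1" using \<open>p \<le> 1\<close> \<open>0 < p\<close> by (simp add: power_le_one)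
    then have "c \<le> 1 / 2 * 1" unfolding c_def using \<kappa>_bounds by (intro mult_mono) auto
    then have c: "0 < c" "c \<le> 1 / 2" using \<kappa>_bounds \<open>0 < p\<close> by (auto simp: c_def)
    have e: "0 < inv_root_mean j x" "0 < inv_root_mean (Suc j) x" using inv_root_mean_pos that by auto
    have "inv_root_mean (Suc j) x / inv_root_mean j x \<le> 1 - c / 2"
      using inv_root_mean_step[of j x] e unfolding v_def[symmetric] p_def[symmetric] c_def[symmetric]
      by (simp add: field_simps)
    then have "ln (inv_root_mean (Suc j) x / inv_root_mean j x) \<le> ln (1 + (- c / 2))"
      using e c by (subst ln_le_cancel_iff) auto
    also have "\<dots> \<le> - c / 2" using c by (intro ln_add_one_self_le_self2) simp
    finally have "c \<le> 2 * ln (inv_root_mean j x / inv_root_mean (Suc j) x)" using e by (simp add: ln_div)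
    also have "\<dots> = ln ((inv_root_mean j x / inv_root_mean (Suc j) x)\<^sup>2)" using e by (simp add: ln_realpow)
    also have "(inv_root_mean j x / inv_root_mean (Suc j) x)\<^sup>2 = v (Suc j) / v j" using e by (simp add: v_def power_divide)
    finally have "4 / p\<^sup>2 * c \<le> 4 / p\<^sup>2 * ln (v (Suc j) / v j)"
      by (rule mult_left_mono) simp
    then have "4 * \<kappa> \<le> 4 / p\<^sup>2 * ln (v (Suc j) / v j)" using \<open>0 < p\<close> by (simp add: c_def)
    then have "ennreal (4 * \<kappa>) \<le> ennreal (4 / p\<^sup>2 * ln (v (Suc j) / v j))"
      by (rule ennreal_leI)
    also have "\<dots> \<le> (\<integral>\<^sup>+u. F u * indicator {v j<..v (Suc j)} u \<partial>lborel)"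
      using v_pos[of j] v_mono[of j "Suc j"] that \<open>0 < p\<close> p by (intro lower) auto
    finally have "ennreal (4 * \<kappa>) + J (v (Suc j)) \<le>
        (\<integral>\<^sup>+u. F u * indicator {v j<..v (Suc j)} u \<partial>lborel) + J (v (Suc j))"
      by (rule add_right_mono)
    also have "\<dots> = (\<integral>\<^sup>+u. F u * indicator {v j<..v (Suc j)} u + F u * indicator {v (Suc j)<..b} u \<partial>lborel)"
      unfolding J_def by (rule nn_integral_add[symmetric]) auto
    also have "\<dots> \<le> J (v j)"
      unfolding J_def using v_mono[of j "Suc j"] v_mono[of "Suc j" m] v_m that
      by (intro nn_integral_mono) (auto split: split_indicator)
    finally show ?thesis .
  qed
  have tele: "ennreal (4 * \<kappa> * real j) + J (v j) \<le> J (v 0)" if "j \<le> m" for j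
    using that
  proof (induction j)
    case (Suc j)
    have "ennreal (4 * \<kappa> * real (Suc j)) + J (v (Suc j)) =
        ennreal (4 * \<kappa> * real j) + (ennreal (4 * \<kappa>) + J (v (Suc j)))"
      using \<kappa>_bounds(1) by (simp add: algebra_simps ennreal_plus)
    also have "\<dots> \<le> ennreal (4 * \<kappa> * real j) + J (v j)"
      using step[OF Suc.prems] by (rule add_left_mono)
    also have "\<dots> \<le> J (v 0)" using Suc by simp
    finally show ?case .
  qed simp
  have "0 < ln (b / v m)" using v_m v_pos[of m] by simp
  then have "0 < ennreal (4 / 1\<^sup>2 * ln (b / v m))" by simp
  also have "\<dots> \<le> J (v m)"
    unfolding J_def using v_m v_pos[of m] \<Phi>_le_1[of "v m"] v_mono[of 0 m] by (intro lower) auto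
  finally have "ennreal (4 * \<kappa> * real m) < ennreal (4 * \<kappa> * real m) + J (v m)"
    by (simp add: ennreal_add_left_cancel_less)
  also have "\<dots> \<le> ennreal (4 * \<kappa> * real m)"
    using tele[OF order_refl] J_I[OF order_refl] by (rule order_trans)
  finally show False by simp
qed

section \<open>Time reversal\<close>

definition reversal :: "'v \<Rightarrow> 'v pmf" where
  "reversal y = embed_pmf (\<lambda>z. \<pi> z * pmf (K z) y / \<pi> y)"

text \<open>Stationarity says precisely that the reversed transition probabilities sum to one.\<close>
lemma pmf_reversal: "\<pi> y * pmf (reversal y) z = \<pi> z * pmf (K z) y"
proof -
  have "(\<integral>\<^sup>+z. ennreal (\<pi> z * pmf (K z) y / \<pi> y) \<partial>count_space UNIV) =
      (\<integral>\<^sup>+z. ennreal (1 / \<pi> y) * ennreal (\<pi> z * pmf (K z) y) \<partial>count_space UNIV)"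
    using \<pi>_pos[of y] by (intro nn_integral_cong) (simp flip: ennreal_mult)
  also have "\<dots> = ennreal (1 / \<pi> y) * ennreal (\<pi> y)"
    using stationary by (subst nn_integral_cmult) (auto simp: stationary_def)
  also have "\<dots> = 1" using \<pi>_pos[of y] by (simp flip: ennreal_mult)
  finally have "pmf (reversal y) z = \<pi> z * pmf (K z) y / \<pi> y"
    unfolding reversal_def by (intro pmf_embed_pmf) auto
  then show ?thesis using \<pi>_pos[of y] by simp
qed

lemma lazy_chain_reversal: "lazy_chain reversal \<pi> \<gamma>"
proof
  show "stationary reversal \<pi>"
    unfolding stationary_def pmf_reversal
  proof
    fix y
    have "(\<integral>\<^sup>+x. ennreal (\<pi> y * pmf (K y) x) \<partial>count_space UNIV) =
        ennreal (\<pi> y) * (\<integral>\<^sup>+x. ennreal (pmf (K y) x) \<partial>count_space UNIV)"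
      by (subst nn_integral_cmult[symmetric]) (auto simp: ennreal_mult)
    then show "(\<integral>\<^sup>+x. ennreal (\<pi> y * pmf (K y) x) \<partial>count_space UNIV) = ennreal (\<pi> y)"
      by (simp add: nn_integral_pmf_eq_1)
  qed
  show "\<gamma> \<le> pmf (reversal v) v" for v
    using pmf_reversal[of v v] lazy[of v] \<pi>_pos[of v] by simp
qed (use \<pi>_pos \<gamma>_pos \<gamma>_le in auto)

interpretation R: lazy_chain reversal \<pi> \<gamma>
  by (rule lazy_chain_reversal)

lemma n_step_reversal: "\<pi> y * pmf (n_step reversal n y) z = \<pi> z * pmf (n_step K n z) y"
proof (induction n arbitrary: y z)
  case 0
  show ?case by (auto simp: pmf_return split: split_indicator)
next
  case (Suc n)
  have "ennreal (\<pi> z * pmf (n_step K (Suc n) z) y) =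
      ennreal (\<pi> z) * (\<integral>\<^sup>+t. ennreal (pmf (K z) t) * ennreal (pmf (n_step K n t) y) \<partial>count_space UNIV)"
    by (simp add: ennreal_mult ennreal_pmf_bind nn_integral_measure_pmf)
  also have "\<dots> = (\<integral>\<^sup>+t. ennreal (\<pi> z * pmf (K z) t * pmf (n_step K n t) y) \<partial>count_space UNIV)"
    by (subst nn_integral_cmult[symmetric]) (auto simp: ennreal_mult mult.assoc)
  also have "(\<lambda>t. \<pi> z * pmf (K z) t * pmf (n_step K n t) y) =
      (\<lambda>t. \<pi> y * (pmf (n_step reversal n y) t * pmf (reversal t) z))"
  proof
    fix t
    have "\<pi> z * pmf (K z) t * pmf (n_step K n t) y = pmf (reversal t) z * (\<pi> t * pmf (n_step K n t) y)"
      by (simp flip: pmf_reversal)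
    also have "\<dots> = \<pi> y * (pmf (n_step reversal n y) t * pmf (reversal t) z)"
      by (simp flip: Suc)
    finally show "\<pi> z * pmf (K z) t * pmf (n_step K n t) y = \<dots>" .
  qed
  also have "(\<integral>\<^sup>+t. ennreal (\<pi> y * (pmf (n_step reversal n y) t * pmf (reversal t) z)) \<partial>count_space UNIV) =
      ennreal (\<pi> y) * (\<integral>\<^sup>+t. ennreal (pmf (n_step reversal n y) t) * ennreal (pmf (reversal t) z) \<partial>count_space UNIV)"
    by (subst nn_integral_cmult[symmetric]) (auto simp: ennreal_mult)
  also have "\<dots> = ennreal (\<pi> y * pmf (n_step reversal (Suc n) y) z)"
    by (simp add: n_step_Suc' ennreal_mult ennreal_pmf_bind nn_integral_measure_pmf del: n_step.simps)
  finally show ?case by (subst (asm) ennreal_inj) auto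
qed

lemma flow_reversal: "flow reversal \<pi> S A = flow K \<pi> A S"
proof -
  have "flow reversal \<pi> S A = (\<integral>\<^sup>+s. indicator S s * (\<integral>\<^sup>+a. indicator A a * ennreal (\<pi> a * pmf (K a) s)
      \<partial>count_space UNIV) \<partial>count_space UNIV)"
    unfolding flow_def pmf_reversal
    by (simp only: nn_integral_restrict_indicator[of S] nn_integral_restrict_indicator[of A])
  also have "\<dots> = (\<integral>\<^sup>+y. indicator S y * inflow A y \<partial>count_space UNIV)"
    by (simp add: inflow_def wsum_def ennreal_mult)
  finally show ?thesis by (simp add: flow_eq)
qed

text \<open>The weight of \<open>S\<close> is the mass staying in \<open>S\<close> plus the mass leaving it, and, by stationarity, also
the mass staying plus the mass entering. Finiteness is needed to cancel the mass that stays.\<close>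
lemma flow_Compl_eq:
  assumes "weight \<pi> S < top"
  shows "flow K \<pi> (- S) S = flow K \<pi> S (- S)"
proof -
  define B where "B = (\<integral>\<^sup>+y. indicator S y * inflow S y \<partial>count_space UNIV)"
  have 1: "B + flow K \<pi> S (- S) = weight \<pi> S"
    unfolding B_def by (rule inside_plus_flow)
  have "B + flow K \<pi> (- S) S =
      (\<integral>\<^sup>+y. indicator S y * (inflow S y + inflow (- S) y) \<partial>count_space UNIV)"
    unfolding B_def flow_eq by (simp add: distrib_left nn_integral_add)
  also have "\<dots> = weight \<pi> S"
    unfolding inflow_Compl wsum_eq_weight[symmetric] wsum_def by simp
  finally have "B + flow K \<pi> (- S) S = B + flow K \<pi> S (- S)" using 1 by simp
  moreover have "B \<noteq> top" using 1 assms by (metis ennreal_add_eq_top less_irrefl)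
  ultimately show ?thesis by (simp add: ennreal_add_left_cancel)
qed

lemma conductance_profile_reversal: "conductance_profile reversal \<pi> r = conductance_profile K \<pi> r"
  unfolding conductance_profile_def
proof (intro INF_cong refl)
  fix S assume "S \<in> {S. S \<noteq> {} \<and> weight \<pi> S \<le> ennreal r}"
  then have "weight \<pi> S < top" by (auto simp: le_less_trans)
  then show "conductance reversal \<pi> S = conductance K \<pi> S"
    by (simp add: conductance_def flow_reversal flow_Compl_eq)
qed

section \<open>The heat kernel bound\<close>

lemma wsum_indicator_le: "wsum (indicator S) S' \<le> root_weight S * root_weight S'"
proof -
  have "wsum (indicator S) S' \<le> weight \<pi> S" "wsum (indicator S) S' \<le> weight \<pi> S'"
    unfolding wsum_eq_weight[symmetric] wsum_def
    by (intro nn_integral_mono; simp split: split_indicator)+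
  then show ?thesis unfolding root_weight_def by (rule le_esqrt_mult_esqrt)
qed

text \<open>By duality \<open>\<pi> x * p\<^sup>m\<^sup>+\<^sup>n(x, y)\<close> is the expectation after \<open>m\<close> moves from \<open>{x}\<close> of the sum of
\<open>\<pi> z * p\<^sup>n(z, y)\<close> over \<open>z \<in> S\<close>. By reversal that sum is \<open>\<pi> y\<close> times the probability that the reversed chain
started at \<open>y\<close> is in \<open>S\<close> after \<open>n\<close> steps, and by duality again it is the expectation of \<open>\<pi>(S \<inter> S')\<close> for
the reversed evolving set \<open>S'\<close> from \<open>{y}\<close>. The product bound for \<open>\<pi>(S \<inter> S')\<close> then separates the two.\<close>
lemma n_step_le_inv_root_mean_product:
  "pmf (n_step K (m + n) x) y / \<pi> y \<le> inv_root_mean m x * R.inv_root_mean n y"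
proof -
  define \<phi> where "\<phi> z = ennreal (pmf (n_step K n z) y)" for z
  have \<phi>: "wsum \<phi> S \<le> (R.evolve ^^ n) root_weight {y} * root_weight S" for S
  proof -
    have "wsum \<phi> S = (\<integral>\<^sup>+z. ennreal (\<pi> y) * (ennreal (pmf (n_step reversal n y) z) * indicator S z) \<partial>count_space UNIV)"
      unfolding wsum_def \<phi>_def
      by (intro nn_integral_cong)
         (simp add: ac_simps n_step_reversal split: split_indicator flip: ennreal_mult)
    also have "\<dots> = wsum (\<lambda>y. \<integral>\<^sup>+z. indicator S z \<partial>measure_pmf (n_step reversal n y)) {y}"
      by (subst nn_integral_cmult) (auto simp: wsum_singleton nn_integral_measure_pmf)
    also have "\<dots> = (R.evolve ^^ n) (wsum (indicator S)) {y}"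
      by (simp only: R.evolve_pow_wsum)
    also have "\<dots> \<le> (R.evolve ^^ n) (\<lambda>S'. root_weight S * root_weight S') {y}"
      by (intro R.evolve_pow_mono wsum_indicator_le)
    also have "\<dots> = (R.evolve ^^ n) root_weight {y} * root_weight S"
      by (subst R.evolve_pow_cmult) (auto simp: mult.commute)
    finally show ?thesis .
  qed
  have "ennreal (\<pi> x * pmf (n_step K (m + n) x) y) = (evolve ^^ m) (wsum \<phi>) {x}"
    by (simp add: evolve_pow_wsum wsum_singleton n_step_add ennreal_pmf_bind \<phi>_def ennreal_mult)
  also have "\<dots> \<le> (evolve ^^ m) (\<lambda>S. (R.evolve ^^ n) root_weight {y} * root_weight S) {x}"
    by (intro evolve_pow_mono \<phi>)
  also have "\<dots> = (R.evolve ^^ n) root_weight {y} * (evolve ^^ m) root_weight {x}"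
    by (rule evolve_pow_cmult) measurable
  also have "\<dots> = ennreal (\<pi> y * R.inv_root_mean n y * (\<pi> x * inv_root_mean m x))"
    using R.evolve_pow_root_weight_singleton[of n y]
    by (simp add: evolve_pow_root_weight_singleton ennreal_mult inv_root_mean_nonneg R.inv_root_mean_nonneg)
  finally have "\<pi> x * pmf (n_step K (m + n) x) y \<le> \<pi> x * (\<pi> y * (inv_root_mean m x * R.inv_root_mean n y))"
    by (subst (asm) ennreal_le_iff) (auto simp: inv_root_mean_nonneg R.inv_root_mean_nonneg ac_simps)
  then show ?thesis using \<pi>_pos[of x] \<pi>_pos[of y] by (simp add: field_simps)
qed

lemma heat_kernel_bound:
  assumes a: "0 < a" "a \<le> 4 * \<pi> x" "a \<le> 4 * \<pi> y" and "0 < \<epsilon>"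
    and I: "(\<integral>\<^sup>+u\<in>{a..4 / \<epsilon>}. 4 / (ennreal u * (conductance_profile K \<pi> u)\<^sup>2) \<partial>lborel) \<le> ennreal (2 * \<kappa> * (real n - 1))"
    and n: "1 \<le> n"
  shows "pmf (n_step K n x) y / \<pi> y \<le> \<epsilon>"
proof -
  define m where "m = n div 2"
  define k where "k = n - m"
  have nmk: "n = m + k" by (simp add: m_def k_def)
  have half: "real n - 1 \<le> 2 * real m" "real n - 1 \<le> 2 * real k"
    unfolding m_def k_def using n by linarith+
  have enough: "(\<integral>\<^sup>+u\<in>{a..4 / \<epsilon>}. 4 / (ennreal u * (conductance_profile K \<pi> u)\<^sup>2) \<partial>lborel)
      \<le> ennreal (4 * \<kappa> * real j)" if "real n - 1 \<le> 2 * real j" for j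
    using mult_left_mono[OF that, of "2 * \<kappa>"] \<kappa>_bounds
    by (intro order_trans[OF I] ennreal_leI) (simp add: ac_simps)
  have "(inv_root_mean m x)\<^sup>2 \<le> \<epsilon>"
    using a(1,2) \<open>0 < \<epsilon>\<close> enough[OF half(1)] by (rule inv_root_mean_square_le)
  moreover have "(R.inv_root_mean k y)\<^sup>2 \<le> \<epsilon>"
    using a(1,3) \<open>0 < \<epsilon>\<close> enough[OF half(2), folded conductance_profile_reversal]
    by (rule R.inv_root_mean_square_le)
  ultimately have "inv_root_mean m x \<le> sqrt \<epsilon>" "R.inv_root_mean k y \<le> sqrt \<epsilon>"
    by (auto intro: real_le_rsqrt)
  then have "inv_root_mean m x * R.inv_root_mean k y \<le> sqrt \<epsilon> * sqrt \<epsilon>"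
    by (intro mult_mono) (auto simp: inv_root_mean_nonneg R.inv_root_mean_nonneg \<open>0 < \<epsilon>\<close> less_imp_le)
  then show ?thesis
    using n_step_le_inv_root_mean_product[of m k x y] \<open>0 < \<epsilon>\<close> unfolding nmk by simp
qed

text \<open>These bounds hold at every time. They settle the case \<open>4 / \<epsilon> < 4 * min (\<pi> x) (\<pi> y)\<close>, in which the
oriented integral is negative and gives no information about \<open>n\<close>.\<close>
lemma n_step_over_le_inverse:
  shows "pmf (n_step K n x) y / \<pi> y \<le> 1 / \<pi> x" "pmf (n_step K n x) y / \<pi> y \<le> 1 / \<pi> y"
proof -
  have "\<pi> x * pmf (n_step K n x) y \<le> \<pi> y * 1"
    unfolding n_step_reversal[symmetric] by (intro mult_left_mono pmf_le_1) auto
  then show "pmf (n_step K n x) y / \<pi> y \<le> 1 / \<pi> x"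
    using \<pi>_pos[of x] \<pi>_pos[of y] by (simp add: field_simps)
  show "pmf (n_step K n x) y / \<pi> y \<le> 1 / \<pi> y"
    using \<pi>_pos[of y] by (intro divide_right_mono pmf_le_1) auto
qed

end

theorem theorem2:
  fixes K :: "'v::countable \<Rightarrow> 'v pmf"
    and \<pi> :: "'v \<Rightarrow> real"
    and \<gamma> \<epsilon> :: real
    and x y :: 'v
    and n :: nat
  assumes "irreducible_chain K"
    and "\<And>v. 0 < \<pi> v"
    and "stationary K \<pi>"
    and "weight \<pi> UNIV = \<infinity>"
    and "0 < \<gamma>" and "\<gamma> \<le> 1 / 2"
    and "\<And>v. \<gamma> \<le> pmf (K v) v"
    and "0 < \<epsilon>"
    and "ereal (real n) \<ge> 1 + ereal ((1 - \<gamma>)\<^sup>2 / \<gamma>\<^sup>2) *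
           oriented_nn_integral (4 * min (\<pi> x) (\<pi> y)) (4 / \<epsilon>)
             (\<lambda>u. 4 / (ennreal u * (conductance_profile K \<pi> u)\<^sup>2))"
  shows "\<bar>pmf (n_step K n x) y / \<pi> y\<bar> \<le> \<epsilon>"
proof -
  interpret lazy_chain K \<pi> \<gamma>
    by unfold_locales (use assms in auto)
  define a where "a = 4 * min (\<pi> x) (\<pi> y)"
  have a: "0 < a" "a \<le> 4 * \<pi> x" "a \<le> 4 * \<pi> y"
    using \<pi>_pos[of x] \<pi>_pos[of y] by (auto simp: a_def)
  have "pmf (n_step K n x) y / \<pi> y \<le> \<epsilon>"
  proof (cases "a \<le> 4 / \<epsilon>")
    case False
    then have "1 / min (\<pi> x) (\<pi> y) \<le> \<epsilon>"
      using \<open>0 < \<epsilon>\<close> \<pi>_pos[of x] \<pi>_pos[of y] by (auto simp: a_def field_simps)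
    then show ?thesis
      using n_step_over_le_inverse[of n x y] by (auto simp: min_def split: if_splits)
  next
    case True
    define I where "I = (\<integral>\<^sup>+u\<in>{a..4 / \<epsilon>}. 4 / (ennreal u * (conductance_profile K \<pi> u)\<^sup>2) \<partial>lborel)"
    define C where "C = (1 - \<gamma>)\<^sup>2 / \<gamma>\<^sup>2"
    have C: "0 < C" "2 * \<kappa> * C = 1" using \<gamma>_pos \<gamma>_le by (auto simp: C_def \<kappa>_def)
    have n: "1 + ereal C * enn2ereal I \<le> ereal (real n)"
      using assms(9) True unfolding oriented_nn_integral_def I_def C_def a_def by simp
    have "I \<noteq> top"
    proof
      assume "I = top"
      then show False using n C by (simp add: top_ennreal.rep_eq)
    qed
    then obtain i where i: "I = ennreal i" "0 \<le> i" by (cases I) auto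
    have n': "1 + C * i \<le> real n" using n i by (simp add: enn2ereal_ennreal one_ereal_def)
    then have "2 * \<kappa> * (C * i) \<le> 2 * \<kappa> * (real n - 1)" using \<kappa>_bounds by (intro mult_left_mono) auto
    then have "i \<le> 2 * \<kappa> * (real n - 1)" using C by (metis mult.assoc mult_1)
    then have "I \<le> ennreal (2 * \<kappa> * (real n - 1))" unfolding i by (rule ennreal_leI)
    moreover have "0 \<le> C * i" using C i by simp
    then have "1 \<le> n" using n' by linarith
    ultimately show ?thesis
      using a \<open>0 < \<epsilon>\<close> unfolding I_def by (intro heat_kernel_bound) auto
  qed
  then show ?thesis using \<pi>_pos[of y] by simp
qed

end
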